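(* The $2$-dimensional coset complexes $\mathfrak{LB}_3^{\mathrm{sm}}(\mathbb{F}_5)$ and $\mathfrak{LB}_3^{\mathrm{lg}}(\mathbb{F}_5)$ have vanishing $1$-(co)homology over $\mathbb{F}_2$.
   Context: The root system $B_3$ consists of all integer vectors in $\mathbb{R}^3$ of length $1$ or $\sqrt2$. Put $\alpha=(1,-1,0)$, $\beta=(0,1,-1)$, $\psi=(0,0,1)$, $\omega=-(\alpha+\beta+\psi)=(-1,0,0)$. For a finite field $\mathbb{F}_q$ of odd order, let $B_3(\mathbb{F}_q)$ be the universal Chevalley group of type $B_3$ with its usual root elements $x_\zeta(t)$ ($\zeta\in B_3$, $t\in\mathbb{F}_q$), satisfying $x_\zeta(t)x_\zeta(u)=x_\zeta(t+u)$ and the Chevalley commutator relations. For linearly independent $I\subset B_3$ let $U_I(\mathbb{F}_q)$ be the subgroup generated by all $x_\zeta(t)$ with $\zeta\in I$, $t\in\mathbb{F}_q$. For a group $\Gamma$ with subgroups $K_0,K_1,K_2$, the coset complex $\mathcal{CC}(\Gamma;\{K_0,K_1,K_2\})$ is the $2$-dimensional simplicial complex on the vertex set $\Gamma/K_0\sqcup\Gamma/K_1\sqcup\Gamma/K_2$ (left cosets) whose maximal faces are the triples $\{gK_0,gK_1,gK_2\}$, $g\in\Gamma$. For a $3$-element linearly independent set $I$ put $\mathfrak{L}_I(\mathbb{F}_q)=\mathcal{CC}\bigl(U_I(\mathbb{F}_q);\{U_{I\setminus\{\zeta\}}(\mathbb{F}_q):\zeta\in I\}\bigr)$. Then $\mathfrak{LB}_3^{\mathrm{sm}}(\mathbb{F}_q)=\mathfrak{L}_{\{\beta,\psi,\omega\}}(\mathbb{F}_q)$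 and $\mathfrak{LB}_3^{\mathrm{lg}}(\mathbb{F}_q)=\mathfrak{L}_{\{\alpha,\beta,\psi\}}(\mathbb{F}_q)$. Vanishing $1$-cohomology over $\mathbb{F}_2$ means that $\ker\delta_1=\mathrm{Im}\,\delta_0$ for the simplicial coboundary maps $\delta_0$ (vertices to edges) and $\delta_1$ (edges to triangles) with $\mathbb{F}_2$ coefficients; for finite complexes this is equivalent to vanishing $1$-homology over $\mathbb{F}_2$. *)

theory Defs
  imports
    "HOL-Analysis.Cartesian_Space"
    "HOL-Algebra.Generated_Groups"
    "HOL-Library.Z2"
begin

section \<open>The root system and the spin representation\<close>

type_synonym vec3 = "int \<times> int \<times> int"

fun dot :: "vec3 \<Rightarrow> vec3 \<Rightarrow> int" where
  "dot (a, b, c) (a', b', c') = a * a' + b * b' + c * c'"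

definition B3 :: "vec3 set" where
  "B3 = {\<zeta>. dot \<zeta> \<zeta> = 1 \<or> dot \<zeta> \<zeta> = 2}"

definition root_alpha :: vec3 where "root_alpha = (1, -1, 0)"
definition root_beta :: vec3 where "root_beta = (0, 1, -1)"
definition root_psi :: vec3 where "root_psi = (0, 0, 1)"
definition root_omega :: vec3 where "root_omega = - (root_alpha + root_beta + root_psi)"

text \<open>
  The universal Chevalley group of type \<open>B\<^sub>3\<close> is realised in Chevalley's way: a Chevalley basis
  of the simple Lie algebra acts on an admissible lattice of a faithful representation whose
  weights span the full weight lattice, and the root elements are the exponentials
  \<open>exp (t e\<^sub>\<zeta>)\<close> reduced to the field. For \<open>B\<^sub>3\<close> the eight-dimensional spin representation has
  this property: its weights are the vectors \<open>(\<plusminus>1/2, \<plusminus>1/2, \<plusminus>1/2)\<close>, which span the weight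
  lattice. A weight is encoded by its signs, and \<open>wt\<close> returns twice the weight, so that adding
  a root \<open>\<zeta>\<close> to a weight means adding \<open>\<zeta> + \<zeta>\<close> to its \<open>wt\<close>.
\<close>

type_synonym spin = "bool \<times> bool \<times> bool"

fun wt :: "spin \<Rightarrow> vec3" where
  "wt (a, b, c) = (if a then 1 else -1, if b then 1 else -1, if c then 1 else -1)"

text \<open>
  The root vector \<open>e\<^sub>\<zeta>\<close> maps the basis vector of weight \<open>\<lambda>\<close> to \<open>\<plusminus>\<close> the one of weight \<open>\<lambda> + \<zeta>\<close>, or to
  \<open>0\<close> if \<open>\<lambda> + \<zeta>\<close> is not a weight. The signs are those of the Jordan--Wigner realisation of
  the Clifford algebra: one factor for every pair \<open>i < k\<close> such that \<open>\<zeta>\<close> is nonzero at position \<open>i\<close>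
  and zero at position \<open>k\<close>. The lemmas below prove that the \<open>e\<^sub>\<zeta>\<close> satisfy the relations of a
  Chevalley basis. Another normalisation of the \<open>e\<^sub>\<zeta>\<close> only replaces \<open>x\<^sub>\<zeta>(t)\<close> by \<open>x\<^sub>\<zeta>(c t)\<close> with a
  unit \<open>c\<close>, which does not affect the subgroups \<open>U\<^sub>I\<close>.
\<close>

fun spin_sign :: "vec3 \<Rightarrow> vec3 \<Rightarrow> int" where
  "spin_sign (z1, z2, z3) (w1, w2, w3) =
     (if z1 \<noteq> 0 \<and> z2 = 0 then w2 else 1) *
     (if z1 \<noteq> 0 \<and> z3 = 0 then w3 else 1) *
     (if z2 \<noteq> 0 \<and> z3 = 0 then w3 else 1)"

definition root_vec :: "vec3 \<Rightarrow> 'k::comm_ring_1 ^ spin ^ spin" where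
  "root_vec \<zeta> = (\<chi> b' b. if wt b' = wt b + (\<zeta> + \<zeta>) then of_int (spin_sign \<zeta> (wt b)) else 0)"

text \<open>
  Since \<open>e\<^sub>\<zeta>\<close> squares to zero (lemma \<open>root_vec_square\<close>), the exponential is \<open>1 + t e\<^sub>\<zeta>\<close>.
\<close>

definition root_elt :: "vec3 \<Rightarrow> 'k::comm_ring_1 \<Rightarrow> 'k ^ spin ^ spin" where
  "root_elt \<zeta> t = mat 1 + (\<chi> b' b. t * root_vec \<zeta> $ b' $ b)"

section \<open>The Chevalley group and its subgroups\<close>

definition GL_spin :: "('k::field ^ spin ^ spin) monoid" where
  "GL_spin = \<lparr>carrier = {A. invertible A}, mult = (**), one = mat 1\<rparr>"

definition B3_group :: "('k::field ^ spin ^ spin) monoid" where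
  "B3_group = GL_spin\<lparr>carrier := generate GL_spin {root_elt \<zeta> t | \<zeta> t. \<zeta> \<in> B3}\<rparr>"

definition U :: "vec3 set \<Rightarrow> ('k::field ^ spin ^ spin) set" where
  "U I = generate B3_group {root_elt \<zeta> t | \<zeta> t. \<zeta> \<in> I}"

section \<open>Coset complexes and first cohomology\<close>

text \<open>
  A simplicial complex is given by its set of nonempty faces. Cosets are tagged by the index
  of their subgroup, which makes the vertex set a disjoint union.
\<close>

definition coset_complex ::
    "('g, 'm) monoid_scheme \<Rightarrow> 'i set \<Rightarrow> ('i \<Rightarrow> 'g set) \<Rightarrow> ('i \<times> 'g set) set set" where
  "coset_complex \<Gamma> I K =
     {\<sigma>. \<sigma> \<noteq> {} \<and> (\<exists>g \<in> carrier \<Gamma>. \<sigma> \<subseteq> {(i, g <#\<^bsub>\<Gamma>\<^esub> K i) | i. i \<in> I})}"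

definition L_complex ::
    "'k::field itself \<Rightarrow> vec3 set \<Rightarrow> (vec3 \<times> ('k ^ spin ^ spin) set) set set" where
  "L_complex _ I = coset_complex (B3_group\<lparr>carrier := U I\<rparr>) I (\<lambda>\<zeta>. U (I - {\<zeta>}))"

definition LB3_sm :: "'k::field itself \<Rightarrow> (vec3 \<times> ('k ^ spin ^ spin) set) set set" where
  "LB3_sm k = L_complex k {root_beta, root_psi, root_omega}"

definition LB3_lg :: "'k::field itself \<Rightarrow> (vec3 \<times> ('k ^ spin ^ spin) set) set set" where
  "LB3_lg k = L_complex k {root_alpha, root_beta, root_psi}"

definition faces :: "'v set set \<Rightarrow> nat \<Rightarrow> 'v set set" where
  "faces X k = {\<sigma> \<in> X. finite \<sigma> \<and> card \<sigma> = Suc k}"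

text \<open>Cochains are extended by zero outside the \<open>k\<close>-faces; \<open>bit\<close> is the field with two elements.\<close>

definition cochains :: "'v set set \<Rightarrow> nat \<Rightarrow> ('v set \<Rightarrow> bit) set" where
  "cochains X k = {f. \<forall>\<sigma>. \<sigma> \<notin> faces X k \<longrightarrow> f \<sigma> = 0}"

definition coboundary :: "'v set set \<Rightarrow> nat \<Rightarrow> ('v set \<Rightarrow> bit) \<Rightarrow> 'v set \<Rightarrow> bit" where
  "coboundary X k f \<tau> =
     (if \<tau> \<in> faces X (Suc k) then \<Sum>\<sigma> | \<sigma> \<in> faces X k \<and> \<sigma> \<subseteq> \<tau>. f \<sigma> else 0)"

definition vanishing_1_cohomology :: "'v set set \<Rightarrow> bool" where
  "vanishing_1_cohomology X \<longleftrightarrow>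
     {f \<in> cochains X 1. coboundary X 1 f = (\<lambda>_. 0)} = coboundary X 0 ` cochains X 0"

section \<open>Verification of the Chevalley relations\<close>

fun is_wt :: "vec3 \<Rightarrow> bool" where
  "is_wt (a, b, c) \<longleftrightarrow> (a = 1 \<or> a = -1) \<and> (b = 1 \<or> b = -1) \<and> (c = 1 \<or> c = -1)"

lemma wt_inj: "wt b = wt c \<longleftrightarrow> b = c"
  by (cases b; cases c) (auto split: if_splits)

lemma is_wt_iff: "is_wt v \<longleftrightarrow> (\<exists>b. wt b = v)"
proof
  obtain a b c where v: "v = (a, b, c)" by (cases v)
  assume "is_wt v"
  then have "wt (a = 1, b = 1, c = 1) = v" by (auto simp: v)
  then show "\<exists>b. wt b = v" ..
qed auto

lemma is_wt_wt: "is_wt (wt b)"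
  using is_wt_iff by blast

lemma root_vec_mult_nth:
  "(root_vec \<zeta> ** root_vec \<eta> :: 'k::comm_ring_1 ^ spin ^ spin) $ b' $ b =
     (if wt b' = wt b + (\<eta> + \<eta>) + (\<zeta> + \<zeta>) \<and> is_wt (wt b + (\<eta> + \<eta>))
      then of_int (spin_sign \<zeta> (wt b + (\<eta> + \<eta>)) * spin_sign \<eta> (wt b)) else 0)"
proof (cases "is_wt (wt b + (\<eta> + \<eta>))")
  case True
  then obtain d where d: "wt d = wt b + (\<eta> + \<eta>)" using is_wt_iff by blast
  have "(root_vec \<zeta> ** root_vec \<eta> :: 'k ^ spin ^ spin) $ b' $ b =
      (\<Sum>c\<in>UNIV. if c = d then root_vec \<zeta> $ b' $ c * root_vec \<eta> $ c $ b else 0)"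
    unfolding matrix_matrix_mult_def vec_lambda_beta
    by (rule sum.cong) (auto simp: root_vec_def d[symmetric] wt_inj)
  also have "\<dots> = root_vec \<zeta> $ b' $ d * root_vec \<eta> $ d $ b" by simp
  finally show ?thesis using True by (simp add: root_vec_def d)
next
  case False
  then have "wt c \<noteq> wt b + (\<eta> + \<eta>)" for c using is_wt_iff by metis
  then show ?thesis using False by (simp add: matrix_matrix_mult_def root_vec_def)
qed

definition B3_list :: "vec3 list" where
  "B3_list = filter (\<lambda>\<zeta>. dot \<zeta> \<zeta> = 1 \<or> dot \<zeta> \<zeta> = 2)
     (List.product [-1, 0, 1] (List.product [-1, 0, 1] [-1, 0, 1]))"

lemma B3_eq: "B3 = set B3_list"
proof -
  have *: "a \<in> {-1, 0, 1}" if "a * a \<le> 2" for a :: int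
  proof (rule ccontr)
    assume "a \<notin> {-1, 0, 1}"
    then have "\<bar>a\<bar> \<ge> 2" by auto
    then have "2 * 2 \<le> \<bar>a\<bar> * \<bar>a\<bar>" by (intro mult_mono) auto
    with that show False by (simp add: abs_mult_self_eq)
  qed
  have "a \<in> {-1, 0, 1} \<and> b \<in> {-1, 0, 1} \<and> c \<in> {-1, 0, 1}" if "dot (a, b, c) (a, b, c) \<le> 2" for a b c
  proof -
    have "a * a \<ge> 0" "b * b \<ge> 0" "c * c \<ge> 0" by auto
    moreover have "a * a + b * b + c * c \<le> 2" using that by simp
    ultimately have "a * a \<le> 2" "b * b \<le> 2" "c * c \<le> 2" by linarith+
    then show ?thesis using * by blast
  qed
  note ** = this
  show ?thesis
  proof (rule Set.set_eqI)
    fix v :: vec3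
    obtain a b c where v: "v = (a, b, c)" by (cases v)
    show "v \<in> B3 \<longleftrightarrow> v \<in> set B3_list"
      using **[of a b c] unfolding B3_def B3_list_def v
      by (auto simp only: set_filter set_product list.set mem_Collect_eq mem_Times_iff fst_conv snd_conv
          simp_thms insert_iff empty_iff)
  qed
qed

definition weights :: "vec3 list" where
  "weights = List.product [-1, 1] (List.product [-1, 1] [-1, 1])"

lemma wt_in_weights: "wt b \<in> set weights"
  by (cases b) (simp add: weights_def)

text \<open>The coefficient of \<open>e\<^sub>\<zeta> e\<^sub>\<eta>\<close> at a basis vector of (doubled) weight \<open>w\<close>.\<close>

definition coef :: "vec3 \<Rightarrow> vec3 \<Rightarrow> vec3 \<Rightarrow> int" where
  "coef \<zeta> \<eta> w = (if is_wt (w + (\<eta> + \<eta>)) then spin_sign \<zeta> (w + (\<eta> + \<eta>)) * spin_sign \<eta> w else 0)"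

lemma bracket_nth:
  "(root_vec \<zeta> ** root_vec \<eta> - root_vec \<eta> ** root_vec \<zeta> :: 'k::comm_ring_1 ^ spin ^ spin) $ b' $ b =
     (if wt b' = wt b + (\<zeta> + \<eta>) + (\<zeta> + \<eta>) then of_int (coef \<zeta> \<eta> (wt b) - coef \<eta> \<zeta> (wt b)) else 0)"
  by (auto simp: root_vec_mult_nth coef_def algebra_simps)

lemma root_vec_square:
  assumes "\<zeta> \<in> B3"
  shows "root_vec \<zeta> ** root_vec \<zeta> = (0 :: 'k::comm_ring_1 ^ spin ^ spin)"
proof -
  have "\<forall>\<zeta>\<in>set B3_list. \<forall>w\<in>set weights. \<not> is_wt (w + (\<zeta> + \<zeta>) + (\<zeta> + \<zeta>))"
    by code_simp
  then show ?thesis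
    using assms wt_in_weights is_wt_wt unfolding B3_eq
    by (simp add: vec_eq_iff root_vec_mult_nth del: split_paired_All) metis
qed

lemma root_vec_uminus:
  assumes "\<zeta> \<in> B3"
  shows "root_vec (- \<zeta>) = transpose (root_vec \<zeta> :: 'k::comm_ring_1 ^ spin ^ spin)"
proof -
  have 1: "\<forall>\<zeta>\<in>set B3_list. \<forall>w\<in>set weights.
      spin_sign (- \<zeta>) (w + (\<zeta> + \<zeta>)) = spin_sign \<zeta> w \<or> \<not> is_wt (w + (\<zeta> + \<zeta>))"
    by code_simp
  have 2: "wt b' = wt b + (- \<zeta> + - \<zeta>) \<longleftrightarrow> wt b = wt b' + (\<zeta> + \<zeta>)" for b b'
    by (auto simp: algebra_simps)
  have "spin_sign (- \<zeta>) (wt b) = spin_sign \<zeta> (wt b')" if "wt b = wt b' + (\<zeta> + \<zeta>)" for b b'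
    using 1 assms wt_in_weights[of b'] is_wt_wt[of b] that unfolding B3_eq by auto
  then show ?thesis
    by (auto simp: vec_eq_iff root_vec_def transpose_def 2 simp del: split_paired_All)
qed

text \<open>The coroot of \<open>\<zeta>\<close> takes the value \<open>dot (wt b) \<zeta> div dot \<zeta> \<zeta>\<close> (exact division) at the weight \<open>wt b / 2\<close>.\<close>

lemma bracket_opposite:
  assumes "\<zeta> \<in> B3"
  shows "root_vec \<zeta> ** root_vec (- \<zeta>) - root_vec (- \<zeta>) ** root_vec \<zeta> =
    (\<chi> b' b. if b' = b then of_int (dot (wt b) \<zeta> div dot \<zeta> \<zeta>) else (0 :: 'k::comm_ring_1))"
proof -
  have "\<forall>\<zeta>\<in>set B3_list. \<forall>w\<in>set weights.
      coef \<zeta> (- \<zeta>) w - coef (- \<zeta>) \<zeta> w = dot w \<zeta> div dot \<zeta> \<zeta>"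
    by code_simp
  then show ?thesis
    using assms wt_in_weights unfolding B3_eq
    by (auto simp: vec_eq_iff bracket_nth wt_inj simp del: vector_minus_component split_paired_All)
qed

text \<open>
  In \<open>B\<^sub>3\<close> the number \<open>p + 1\<close>, for the \<open>\<zeta>\<close>-string \<open>\<eta> - p \<zeta>, \<dots>, \<eta> + q \<zeta>\<close> with \<open>\<zeta> + \<eta>\<close> a root, is
  \<open>2\<close> if \<open>\<zeta>\<close> and \<open>\<eta>\<close> are both short and \<open>1\<close> otherwise.
\<close>

lemma bracket_root:
  assumes "\<zeta> \<in> B3" "\<eta> \<in> B3" "\<zeta> + \<eta> \<in> B3"
  obtains s :: int where "s = 1 \<or> s = -1"
    and "root_vec \<zeta> ** root_vec \<eta> - root_vec \<eta> ** root_vec \<zeta> =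
      (\<chi> b' b. of_int (s * (if dot \<zeta> \<zeta> = 1 \<and> dot \<eta> \<eta> = 1 then 2 else 1)) *
        (root_vec (\<zeta> + \<eta>) $ b' $ b :: 'k::comm_ring_1))"
proof -
  let ?c = "if dot \<zeta> \<zeta> = 1 \<and> dot \<eta> \<eta> = 1 then 2 else 1 :: int"
  have "\<forall>\<zeta>\<in>set B3_list. \<forall>\<eta>\<in>set B3_list. \<zeta> + \<eta> \<in> set B3_list \<longrightarrow>
      (\<exists>s\<in>set [1, -1]. \<forall>w\<in>set weights. is_wt (w + (\<zeta> + \<eta>) + (\<zeta> + \<eta>)) \<longrightarrow>
        coef \<zeta> \<eta> w - coef \<eta> \<zeta> w =
          s * (if dot \<zeta> \<zeta> = 1 \<and> dot \<eta> \<eta> = 1 then 2 else 1) * spin_sign (\<zeta> + \<eta>) w)"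
    by code_simp
  from this[rule_format, OF assms[unfolded B3_eq]]
  obtain s where s: "s \<in> set [1, -1]"
    and *: "\<forall>w\<in>set weights. is_wt (w + (\<zeta> + \<eta>) + (\<zeta> + \<eta>)) \<longrightarrow>
      coef \<zeta> \<eta> w - coef \<eta> \<zeta> w = s * ?c * spin_sign (\<zeta> + \<eta>) w"
    by blast
  have "coef \<zeta> \<eta> (wt b) - coef \<eta> \<zeta> (wt b) = s * ?c * spin_sign (\<zeta> + \<eta>) (wt b)"
    if "wt b' = wt b + (\<zeta> + \<eta>) + (\<zeta> + \<eta>)" for b b'
    using *[rule_format, OF wt_in_weights, of b] is_wt_wt[of b'] unfolding that by blast
  then have "root_vec \<zeta> ** root_vec \<eta> - root_vec \<eta> ** root_vec \<zeta> =
      (\<chi> b' b. of_int (s * ?c) * (root_vec (\<zeta> + \<eta>) $ b' $ b :: 'k))"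
    unfolding vec_eq_iff bracket_nth
    by (simp add: root_vec_def add.assoc del: split_paired_All)
  moreover have "s = 1 \<or> s = -1" using s by simp
  ultimately show thesis using that by blast
qed

lemma bracket_nonroot:
  assumes "\<zeta> \<in> B3" "\<eta> \<in> B3" "\<zeta> + \<eta> \<notin> B3" "\<zeta> + \<eta> \<noteq> 0"
  shows "root_vec \<zeta> ** root_vec \<eta> - root_vec \<eta> ** root_vec \<zeta> = (0 :: 'k::comm_ring_1 ^ spin ^ spin)"
proof -
  have "\<forall>\<zeta>\<in>set B3_list. \<forall>\<eta>\<in>set B3_list. \<zeta> + \<eta> \<in> set ((0, 0, 0) # B3_list) \<or>
      (\<forall>w\<in>set weights. is_wt (w + (\<zeta> + \<eta>) + (\<zeta> + \<eta>)) \<longrightarrow> coef \<zeta> \<eta> w - coef \<eta> \<zeta> w = 0)"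
    by code_simp
  moreover have "\<zeta> + \<eta> \<notin> set ((0, 0, 0) # B3_list)"
    using assms(3,4) unfolding B3_eq zero_prod_def by simp
  ultimately have *: "\<forall>w\<in>set weights. is_wt (w + (\<zeta> + \<eta>) + (\<zeta> + \<eta>)) \<longrightarrow>
      coef \<zeta> \<eta> w - coef \<eta> \<zeta> w = 0"
    using assms(1,2) unfolding B3_eq by blast
  have "coef \<zeta> \<eta> (wt b) - coef \<eta> \<zeta> (wt b) = 0"
    if "wt b' = wt b + (\<zeta> + \<eta>) + (\<zeta> + \<eta>)" for b b'
    using *[rule_format, OF wt_in_weights, of b] is_wt_wt[of b'] unfolding that by blast
  then show ?thesis
    unfolding vec_eq_iff bracket_nth by (simp del: split_paired_All)
qed

lemma root_elt_add:
  assumes "\<zeta> \<in> B3"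
  shows "root_elt \<zeta> t ** root_elt \<zeta> u = (root_elt \<zeta> (t + u) :: 'k::comm_ring_1 ^ spin ^ spin)"
proof -
  let ?m = "\<lambda>t. (\<chi> b' b. t * root_vec \<zeta> $ b' $ b) :: 'k ^ spin ^ spin"
  have "(?m t ** ?m u) $ b' $ b = t * u * (root_vec \<zeta> ** root_vec \<zeta>) $ b' $ b" for b' b
    by (simp add: matrix_matrix_mult_def sum_distrib_left algebra_simps)
  then have "?m t ** ?m u = 0"
    by (simp add: vec_eq_iff root_vec_square[OF assms])
  moreover have "?m t + ?m u = ?m (t + u)"
    by (simp add: vec_eq_iff algebra_simps)
  moreover have "(A + B) ** C = A ** C + B ** C" for A B C :: "'k ^ spin ^ spin"
    by (simp add: matrix_matrix_mult_def vec_eq_iff sum.distrib algebra_simps)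
  ultimately show ?thesis
    unfolding root_elt_def by (simp add: matrix_add_ldistrib add.assoc)
qed

lemma root_elt_zero: "root_elt \<zeta> 0 = mat 1"
  by (simp add: root_elt_def vec_eq_iff)

lemma root_elt_in_GL: "\<zeta> \<in> B3 \<Longrightarrow> root_elt \<zeta> t \<in> carrier (GL_spin :: ('k::field ^ spin ^ spin) monoid)"
  unfolding GL_spin_def invertible_def
  using root_elt_add[of \<zeta> t "- t"] root_elt_add[of \<zeta> "- t" t] by (auto simp: root_elt_zero)

end

theory Submission
  imports Defs "HOL-Number_Theory.Residues"
begin

text \<open>
  Let \<open>a\<close>, \<open>y\<close>, \<open>z\<close> be the three root subgroups, where \<open>a\<close> commutes with \<open>y\<close>. In both cases the group
  is a semidirect product of the subgroup \<open>B\<close> generated by \<open>y\<close>, \<open>z\<close> and an elementary abelian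
  \<open>5\<close>-group \<open>Q\<close> containing \<open>a\<close>. A cocycle amounts to functions \<open>fb\<close>, \<open>fc\<close> on the group, invariant
  under right multiplication by \<open>z\<close> and \<open>y\<close>, such that \<open>fb + fc\<close> is invariant under \<open>a\<close>. As \<open>|Q|\<close> is odd,
  averaging reduces to the case that they are invariant under left multiplication by a subgroup
  \<open>H\<close> of \<open>Q\<close> with cyclic quotient. For \<open>g \<in> B\<close> the function \<open>q \<mapsto> fc g + fc (q g)\<close> on \<open>Q\<close> does not
  change if \<open>g\<close> is multiplied by \<open>y\<close>; if \<open>g a g\<inverse> \<notin> H\<close>, it equals \<open>q \<mapsto> fb g + fb (q g)\<close>, which does not change
  if \<open>g\<close> is multiplied by \<open>z\<close>. So if the set of all \<open>g \<in> B\<close> with \<open>g a g\<inverse> \<notin> H\<close> is connected under right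
  multiplication by \<open>y\<close> and \<open>z\<close>, this function does not depend on \<open>g\<close>, and it splits the cocycle.
  Connectedness holds because every line \<open>g z(t)\<close> that meets this set contains at most one point
  outside of it.
\<close>

section \<open>One-parameter subgroups\<close>

text \<open>The characteristic divides the prime order and is not 1, so it equals the order and
  \<open>of_nat\<close> is injective below it. Counting then gives surjectivity.\<close>

lemma range_of_nat_prime_field:
  assumes "prime CARD('k::{field,finite})"
  shows "\<exists>n. (t :: 'k) = of_nat n"
proof -
  have "CHAR('k) dvd CARD('k)" by (rule CHAR_dvd_CARD)
  moreover have "CHAR('k) \<noteq> 1" by simp
  ultimately have char: "CHAR('k) = CARD('k)"
    using assms by (metis prime_nat_iff)
  have "inj_on (of_nat :: nat \<Rightarrow> 'k) {..<CARD('k)}"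
    by (auto simp: inj_on_def of_nat_eq_iff_cong_CHAR char cong_def)
  then have "card ((of_nat :: nat \<Rightarrow> 'k) ` {..<CARD('k)}) = CARD('k)"
    by (simp add: card_image)
  then have "(of_nat :: nat \<Rightarrow> 'k) ` {..<CARD('k)} = UNIV"
    by (metis card_subset_eq finite subset_UNIV)
  then show ?thesis by (metis UNIV_I imageE)
qed

text \<open>The claim proved by rule induction is that right multiplication by \<open>g\<close>
  carries \<open>P\<close> along from any \<open>h\<close>. Unlike \<open>P\<close> itself, this is
  stable under products.\<close>

lemma (in group) generate_right_induct [consumes 1, case_names subset inv one right]:
  assumes "g \<in> generate G S" and S: "S \<subseteq> carrier G" and inv: "\<And>s. s \<in> S \<Longrightarrow> inv s \<in> S"
    and one: "P \<one>" and right: "\<And>g s. g \<in> carrier G \<Longrightarrow> P g \<Longrightarrow> s \<in> S \<Longrightarrow> P (g \<otimes> s)"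
  shows "P g"
proof -
  have "\<forall>h\<in>carrier G. P h \<longrightarrow> P (h \<otimes> g)"
    using assms(1)
  proof (induction rule: generate.induct)
    case one then show ?case by simp
  next
    case (incl s) then show ?case using right by blast
  next
    case (inv s) then show ?case using right assms(3) by blast
  next
    case (eng g1 g2)
    have "g1 \<in> carrier G" "g2 \<in> carrier G"
      using eng.hyps generate_in_carrier[OF S] by auto
    then show ?case using eng.IH by (metis m_assoc m_closed)
  qed
  then have "P (\<one> \<otimes> g)" using one by blast
  then show ?thesis using generate_in_carrier[OF S assms(1)] by simp
qed

definition (in group) one_param :: "('k::field \<Rightarrow> 'a) \<Rightarrow> bool" where
  "one_param x \<longleftrightarrow> (\<forall>t. x t \<in> carrier G) \<and> (\<forall>s t. x s \<otimes> x t = x (s + t))"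

context group
begin

lemma one_param_closed: "one_param x \<Longrightarrow> x t \<in> carrier G"
  by (simp add: one_param_def)

lemma one_param_add: "one_param x \<Longrightarrow> x s \<otimes> x t = x (s + t)"
  by (simp add: one_param_def)

lemma one_param_0: "one_param x \<Longrightarrow> x 0 = \<one>"
  by (metis add.right_neutral one_param_def r_cancel_one)

lemma one_param_inv: "one_param x \<Longrightarrow> inv (x t) = x (- t)"
  by (metis add.left_inverse inv_equality one_param_0 one_param_def)

text \<open>Over a prime field \<open>t / s\<close> is a natural number, so \<open>x t\<close> is a
  power of \<open>x s\<close>.\<close>

lemma one_param_subgroup:
  fixes x :: "'k::{field,finite} \<Rightarrow> 'a"
  assumes "one_param x" "subgroup H G" "prime CARD('k)" "x s \<in> H" "s \<noteq> 0"
  shows "x t \<in> H"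
proof -
  obtain n where n: "t / s = of_nat n" using range_of_nat_prime_field[OF assms(3)] by blast
  have "x (of_nat m * s) \<in> H" for m
  proof (induction m)
    case 0
    then show ?case using assms(1,2) by (simp add: one_param_0 subgroup.one_closed)
  next
    case (Suc m)
    have "x (of_nat (Suc m) * s) = x s \<otimes> x (of_nat m * s)"
      using assms(1) by (simp add: one_param_add algebra_simps)
    then show ?case using Suc assms(2,4) by (simp add: subgroup.m_closed)
  qed
  from this[of n] show ?thesis using assms(5) by (simp flip: n)
qed

end

section \<open>Connectedness of sets with thick lines\<close>

lemma avoid_two:
  assumes "CARD('k::finite) > 2"
  shows "\<exists>x :: 'k. x \<noteq> u \<and> x \<noteq> v"
proof -
  have "card {u, v} \<le> 2" by (simp add: card_insert_if)
  then have "{u, v} \<noteq> (UNIV :: 'k set)" using assms by force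
  then show ?thesis by blast
qed

text \<open>The complements of affine subspaces of a line have this shape: nothing, everything, or
  all but one point.\<close>

definition thick :: "('k \<Rightarrow> bool) \<Rightarrow> bool" where
  "thick P \<longleftrightarrow> (\<exists>t. P t) \<longrightarrow> (\<exists>t0. \<forall>t. t \<noteq> t0 \<longrightarrow> P t)"

text \<open>Each set misses at most one point, and the line has a third one.\<close>

lemma thick_common:
  assumes "thick P" "thick Q" "P s" "Q t" "CARD('k::finite) > 2"
  shows "\<exists>x :: 'k. P x \<and> Q x"
  using assms avoid_two unfolding thick_def by metis

text \<open>Thick horizontal lines allow both points to be moved to a common abscissa
  \<open>x\<close>, and a vertical move joins the results.\<close>

lemma square_connected:
  fixes P :: "'k::finite \<Rightarrow> 'k \<Rightarrow> bool"
  assumes "CARD('k) > 2"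
    and "\<And>y. thick (\<lambda>x. P x y)"
    and x: "\<And>x x' y. P x y \<Longrightarrow> P x' y \<Longrightarrow> f x y = f x' y"
    and y: "\<And>x y y'. P x y \<Longrightarrow> P x y' \<Longrightarrow> f x y = f x y'"
    and "P x0 y0" "P x1 y1"
  shows "f x0 y0 = f x1 y1"
proof -
  obtain x where "P x y0" "P x y1"
    using thick_common[OF assms(2)[of y0] assms(2)[of y1]] assms by blast
  then show ?thesis using assms by metis
qed

text \<open>As in the square, a common \<open>x\<close> is found first. A common \<open>y\<close>
  then leaves two points that differ in \<open>z\<close> only.\<close>

lemma cube_connected:
  fixes P :: "'k::finite \<Rightarrow> 'k \<Rightarrow> 'k \<Rightarrow> bool"
  assumes "CARD('k) > 2"
    and "\<And>y z. thick (\<lambda>x. P x y z)" "\<And>x z. thick (\<lambda>y. P x y z)"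
    and x: "\<And>x x' y z. P x y z \<Longrightarrow> P x' y z \<Longrightarrow> f x y z = f x' y z"
    and y: "\<And>x y y' z. P x y z \<Longrightarrow> P x y' z \<Longrightarrow> f x y z = f x y' z"
    and z: "\<And>x y z z'. P x y z \<Longrightarrow> P x y z' \<Longrightarrow> f x y z = f x y z'"
    and "P x0 y0 z0" "P x1 y1 z1"
  shows "f x0 y0 z0 = f x1 y1 z1"
proof -
  obtain x where 1: "P x y0 z0" "P x y1 z1"
    using thick_common[OF assms(2)[of y0 z0] assms(2)[of y1 z1]] assms by blast
  obtain y where 2: "P x y z0" "P x y z1"
    using thick_common[OF assms(3)[of x z0] assms(3)[of x z1] 1] assms(1) by blast
  have "f x0 y0 z0 = f x y z0" using 1 2 assms(7) x y by metis
  also have "\<dots> = f x y z1" using 2 z by blast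
  also have "\<dots> = f x1 y1 z1" using 1 2 assms(8) x y by metis
  finally show ?thesis .
qed

section \<open>Cocycles on a semidirect product\<close>

text \<open>
  \<open>D\<close> is the projection onto the factor \<open>B\<close> generated by \<open>y\<close> and \<open>z\<close>, and \<open>e\<close> describes the commutators
  of \<open>z\<close> with \<open>a 1\<close>.
\<close>

locale amalgam = group G for G (structure) +
  fixes a y z e :: "'k::{field,finite} \<Rightarrow> 'a" and D :: "'a \<Rightarrow> 'a"
  assumes card_k: "CARD('k) = 5"
    and fin: "finite (carrier G)"
    and hom_a: "one_param a" and hom_y: "one_param y" and hom_z: "one_param z" and hom_e: "one_param e"
    and gen: "carrier G = generate G (range a \<union> range y \<union> range z)"
    and D_mult: "g \<in> carrier G \<Longrightarrow> h \<in> carrier G \<Longrightarrow> D (g \<otimes> h) = D g \<otimes> D h"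
    and D_a: "D (a t) = \<one>" and D_y: "D (y t) = y t" and D_z: "D (z t) = z t"
    and D_e: "D (e t) = \<one>"
    and ker_comm: "p \<in> carrier G \<Longrightarrow> q \<in> carrier G \<Longrightarrow> D p = \<one> \<Longrightarrow> D q = \<one> \<Longrightarrow> p \<otimes> q = q \<otimes> p"
    and ker_exp: "q \<in> carrier G \<Longrightarrow> D q = \<one> \<Longrightarrow> q [^] (5::nat) = \<one>"
    and ay: "a s \<otimes> y t = y t \<otimes> a s"
    and za: "z t \<otimes> a 1 = a 1 \<otimes> e t \<otimes> z t"
begin

definition Q where "Q = {q \<in> carrier G. D q = \<one>}"
definition B where "B = {g \<in> carrier G. D g = g}"

lemma closed [simp]: "a t \<in> carrier G" "y t \<in> carrier G" "z t \<in> carrier G" "e t \<in> carrier G"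
  using hom_a hom_y hom_z hom_e by (simp_all add: one_param_closed)

lemma prime_k: "prime CARD('k)"
  using card_k by simp

lemma carrier_induct [consumes 1, case_names one a y z]:
  assumes "g \<in> carrier G" "P \<one>"
    "\<And>g t. g \<in> carrier G \<Longrightarrow> P g \<Longrightarrow> P (g \<otimes> a t)"
    "\<And>g t. g \<in> carrier G \<Longrightarrow> P g \<Longrightarrow> P (g \<otimes> y t)"
    "\<And>g t. g \<in> carrier G \<Longrightarrow> P g \<Longrightarrow> P (g \<otimes> z t)"
  shows "P g"
proof -
  have "g \<in> generate G (range a \<union> range y \<union> range z)" using assms(1) gen by blast
  then show ?thesis
  proof (induction rule: generate_right_induct)
    show "inv s \<in> range a \<union> range y \<union> range z" if "s \<in> range a \<union> range y \<union> range z" for s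
      using that by (auto simp: hom_a hom_y hom_z one_param_inv)
  qed (use assms in auto)
qed

lemma D_one: "D \<one> = \<one>"
  using D_a[of 0] by (simp add: one_param_0[OF hom_a])

text \<open>\<open>D\<close> kills \<open>a\<close> and fixes \<open>y\<close> and \<open>z\<close>,
  so it is a retraction of the group onto \<open>B\<close>.\<close>

lemma D_in_B:
  assumes "g \<in> carrier G" shows "D g \<in> B"
  using assms
  by (induction rule: carrier_induct) (auto simp: B_def D_one D_mult D_a D_y D_z)

lemma D_closed: "g \<in> carrier G \<Longrightarrow> D g \<in> carrier G"
  using D_in_B by (auto simp: B_def)

lemma B_closed: "g \<in> B \<Longrightarrow> g \<in> carrier G"
  by (simp add: B_def)

lemma B_mult [simp]: "g \<in> B \<Longrightarrow> g \<otimes> y t \<in> B" "g \<in> B \<Longrightarrow> g \<otimes> z t \<in> B"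
  by (auto simp: B_def D_mult D_y D_z)

lemma y_in_B: "y t \<in> B" and z_in_B: "z t \<in> B"
  by (auto simp: B_def D_y D_z)

lemma B_mult': "g \<in> B \<Longrightarrow> h \<in> B \<Longrightarrow> g \<otimes> h \<in> B"
  by (auto simp: B_def D_mult)

text \<open>Induction over the whole group is applied to \<open>P (D g)\<close>, on which steps by
  \<open>a\<close> have no effect. So \<open>B\<close> is generated by \<open>y\<close> and
  \<open>z\<close> alone.\<close>

lemma B_induct [consumes 1, case_names one y z]:
  assumes "g \<in> B" "P \<one>"
    "\<And>g t. g \<in> B \<Longrightarrow> P g \<Longrightarrow> P (g \<otimes> y t)"
    "\<And>g t. g \<in> B \<Longrightarrow> P g \<Longrightarrow> P (g \<otimes> z t)"
  shows "P g"
proof -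
  have "g \<in> carrier G" "D g = g" using assms(1) by (auto simp: B_def)
  have "P (D g)" using \<open>g \<in> carrier G\<close>
    by (induction rule: carrier_induct) (use assms(2-) D_in_B D_closed in \<open>auto simp: D_one D_mult D_a D_y D_z\<close>)
  then show ?thesis using \<open>D g = g\<close> by simp
qed

lemma D_inv: "g \<in> carrier G \<Longrightarrow> D (inv g) = inv (D g)"
  by (metis D_closed D_mult D_one inv_closed inv_equality l_inv)

lemma Q_closed: "q \<in> Q \<Longrightarrow> q \<in> carrier G"
  by (simp add: Q_def)

lemma Q_comm: "p \<in> Q \<Longrightarrow> q \<in> Q \<Longrightarrow> p \<otimes> q = q \<otimes> p"
  using ker_comm by (simp add: Q_def)

lemma Q_subgroup: "subgroup Q G"
  by (rule subgroupI) (auto simp: Q_def D_mult D_inv D_one intro: one_closed)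

lemma Q_conj: "q \<in> Q \<Longrightarrow> g \<in> carrier G \<Longrightarrow> g \<otimes> q \<otimes> inv g \<in> Q"
  by (auto simp: Q_def D_mult D_inv D_closed)

lemma Q_generators [simp]: "a t \<in> Q" "e t \<in> Q"
  by (auto simp: Q_def D_a D_e)

text \<open>This gives the semidirect decomposition of \<open>g\<close> into a factor from
  \<open>Q\<close> and the factor \<open>D g\<close> from \<open>B\<close>.\<close>

lemma Q_part: "g \<in> carrier G \<Longrightarrow> g \<otimes> inv (D g) \<in> Q"
  using D_in_B[of g] by (auto simp: Q_def B_def D_mult D_inv)

text \<open>Testing the single value \<open>a 1\<close> is enough: over a prime field, all
  conjugates of \<open>a t\<close> by \<open>g\<close> lie in \<open>H\<close> as soon as this one
  does.\<close>

definition S where "S H = {g \<in> B. g \<otimes> a 1 \<otimes> inv g \<notin> H}"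

text \<open>Since \<open>y\<close> commutes with \<open>a\<close>, the conjugate of
  \<open>a 1\<close> that decides membership does not change.\<close>

lemma S_y_iff: "g \<in> B \<Longrightarrow> g \<otimes> y t \<in> S H \<longleftrightarrow> g \<in> S H"
proof -
  assume g: "g \<in> B"
  then have [simp]: "g \<in> carrier G" by (rule B_closed)
  have "g \<otimes> y t \<otimes> a 1 \<otimes> inv (g \<otimes> y t) = g \<otimes> (y t \<otimes> a 1) \<otimes> inv (y t) \<otimes> inv g"
    by (simp add: inv_mult_group m_assoc)
  also have "\<dots> = g \<otimes> (a 1 \<otimes> y t) \<otimes> inv (y t) \<otimes> inv g" by (simp add: ay)
  also have "\<dots> = g \<otimes> a 1 \<otimes> inv g" by (simp add: m_assoc inv_solve_right)
  finally show ?thesis using g by (simp add: S_def)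
qed

text \<open>Along a line in direction \<open>z\<close>, the conjugate of \<open>a 1\<close> runs
  through a coset of a one-parameter subgroup, namely that of the conjugated
  \<open>e t\<close>.\<close>

lemma conj_z:
  assumes [simp]: "g \<in> carrier G"
  shows "g \<otimes> z t \<otimes> a 1 \<otimes> inv (g \<otimes> z t) = (g \<otimes> a 1 \<otimes> inv g) \<otimes> (g \<otimes> e t \<otimes> inv g)"
proof -
  have "g \<otimes> z t \<otimes> a 1 \<otimes> inv (g \<otimes> z t) = g \<otimes> (z t \<otimes> a 1) \<otimes> inv (z t) \<otimes> inv g"
    by (simp add: inv_mult_group m_assoc)
  also have "\<dots> = g \<otimes> (a 1 \<otimes> e t \<otimes> z t) \<otimes> inv (z t) \<otimes> inv g" by (simp only: za)
  also have "\<dots> = (g \<otimes> a 1 \<otimes> inv g) \<otimes> (g \<otimes> e t \<otimes> inv g)"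
    by (simp add: m_assoc inv_solve_left flip: m_assoc[of "inv g" g] m_assoc[of "z t" "inv (z t)"])
  finally show ?thesis .
qed

lemma conj_one_param:
  assumes "one_param x" and [simp]: "g \<in> carrier G"
  shows "one_param (\<lambda>t. g \<otimes> x t \<otimes> inv g)"
proof -
  have [simp]: "x t \<in> carrier G" for t using assms(1) by (simp add: one_param_closed)
  have "g \<otimes> x s \<otimes> inv g \<otimes> (g \<otimes> x t \<otimes> inv g) = g \<otimes> (x s \<otimes> x t) \<otimes> inv g" for s t
    by (simp add: m_assoc flip: m_assoc[of "inv g" g])
  then show ?thesis using assms(1) by (simp add: one_param_def)
qed

text \<open>If the coset of \<open>conj_z\<close> meets \<open>H\<close> for two parameters, their
  quotient puts the whole one-parameter subgroup into \<open>H\<close>. Then the coset lies in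
  \<open>H\<close> and the line misses \<open>S H\<close> altogether.\<close>

lemma thick_S:
  assumes H: "subgroup H G" and g: "g \<in> B"
  shows "thick (\<lambda>t. g \<otimes> z t \<in> S H)"
proof (rule ccontr)
  let ?x = "\<lambda>t. g \<otimes> e t \<otimes> inv g" and ?d = "g \<otimes> a 1 \<otimes> inv g"
  have [simp]: "g \<in> carrier G" using g by (rule B_closed)
  have x: "one_param ?x" by (rule conj_one_param[OF hom_e]) simp
  have iff: "g \<otimes> z t \<in> S H \<longleftrightarrow> ?d \<otimes> ?x t \<notin> H" for t
    using g conj_z[of g t] by (simp add: S_def)
  assume "\<not> thick (\<lambda>t. g \<otimes> z t \<in> S H)"
  then obtain t where t: "g \<otimes> z t \<in> S H" and *: "\<And>t0. \<exists>t. t \<noteq> t0 \<and> g \<otimes> z t \<notin> S H"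
    unfolding thick_def by blast
  obtain t1 where t1: "g \<otimes> z t1 \<notin> S H" using * by blast
  obtain t2 where t2: "t2 \<noteq> t1" "g \<otimes> z t2 \<notin> S H" using * by blast
  have "?d \<otimes> ?x t2 = ?d \<otimes> ?x t1 \<otimes> ?x (t2 - t1)"
    using one_param_add[OF x, of t1 "t2 - t1"] by (simp add: m_assoc)
  then have "?x (t2 - t1) = inv (?d \<otimes> ?x t1) \<otimes> (?d \<otimes> ?x t2)"
    by (simp add: inv_solve_left)
  then have "?x (t2 - t1) \<in> H"
    using H t1 t2(2) iff by (metis subgroup.m_closed subgroup.m_inv_closed)
  then have "?x (t - t1) \<in> H"
    using one_param_subgroup[OF x H prime_k] t2(1) by (metis eq_iff_diff_eq_0)
  then have "?d \<otimes> ?x t1 \<otimes> ?x (t - t1) \<in> H"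
    using H t1 iff by (simp add: subgroup.m_closed)
  moreover have "?d \<otimes> ?x t1 \<otimes> ?x (t - t1) = ?d \<otimes> ?x t"
    using one_param_add[OF x, of t1 "t - t1"] by (simp add: m_assoc)
  ultimately show False using t iff by simp
qed

end

section \<open>Sums modulo 2 over the lines of a plane with 25 points\<close>

declare add_bit_eq_xor [simp del]

lemma bit_add_self [simp]: "(x :: bit) + x = 0"
  by (simp flip: mult_2)

lemma bit_add_self_left [simp]: "(x :: bit) + (x + y) = y"
  by (simp flip: add.assoc)

text \<open>The lines through the origin are the five of slope \<open>s\<close> and the line
  \<open>i = 0\<close>. Together with the sum over the plane, the origin is counted seven times and
  every other point twice.\<close>

lemma bit_sum_identity:
  fixes F :: "nat \<Rightarrow> nat \<Rightarrow> bit"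
  shows "F 0 0 = (\<Sum>s<5. \<Sum>i<5. F i ((s * i) mod 5)) + ((\<Sum>j<5. F 0 j) + (\<Sum>j<5. \<Sum>i<5. F i j))"
proof -
  define T where "T i = (\<Sum>j<5. F i j)" for i
  have 5: "{..<5 :: nat} = {0, 1, 2, 3, 4}" by auto
  \<comment> \<open>Multiplication by a nonzero \<open>i\<close> permutes the residues modulo 5. For
    \<open>i = 0\<close> the same sum is five times \<open>F 0 0\<close>.\<close>
  have "(\<Sum>s<5. F i ((s * i) mod 5)) = T i" if "i \<in> {1, 2, 3, 4}" for i
    using that by (elim insertE emptyE) (simp_all add: T_def 5 ac_simps flip: numeral_2_eq_2)
  moreover have "(\<Sum>s<5. F 0 ((s * 0) mod 5)) = F 0 0" by (simp add: 5)
  ultimately have 1: "(\<Sum>i<5. \<Sum>s<5. F i ((s * i) mod 5)) = F 0 0 + (T 1 + (T 2 + (T 3 + T 4)))"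
    by (simp add: 5)
  have 2: "(\<Sum>i<5. T i) = T 0 + (T 1 + (T 2 + (T 3 + T 4)))" by (simp add: 5)
  have 3: "(\<Sum>s<5. \<Sum>i<5. F i ((s * i) mod 5)) = (\<Sum>i<5. \<Sum>s<5. F i ((s * i) mod 5))"
    and 4: "(\<Sum>j<5. \<Sum>i<5. F i j) = (\<Sum>i<5. T i)"
    unfolding T_def by (rule sum.swap)+
  show ?thesis unfolding 3 4 1 2 T_def[of 0, symmetric] by (simp add: add.assoc)
qed

section \<open>Cocycles, averaging, and reduction to cyclic quotients\<close>

context amalgam
begin

text \<open>
  The values of a \<open>1\<close>-cocycle on the three types of edges are pulled back to functions on \<open>G\<close>; the third
  of these functions is \<open>fb + fc\<close>.
\<close>

definition cocycle :: "('a \<Rightarrow> bit) \<Rightarrow> ('a \<Rightarrow> bit) \<Rightarrow> bool" where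
  "cocycle fb fc \<longleftrightarrow> (\<forall>g\<in>carrier G. \<forall>t. fc (g \<otimes> y t) = fc g \<and> fb (g \<otimes> z t) = fb g \<and>
     fb (g \<otimes> a t) + fc (g \<otimes> a t) = fb g + fc g)"

text \<open>\<open>u\<close> is the part of a 0-cochain on the cosets of the subgroup generated by
  \<open>y\<close> and \<open>z\<close>. The other two parts are \<open>fc + u\<close> and
  \<open>fb + u\<close>; for a cocycle the invariance of the latter follows, so \<open>fb\<close>
  does not occur here.\<close>

definition split :: "('a \<Rightarrow> bit) \<Rightarrow> bool" where
  "split fc \<longleftrightarrow> (\<exists>u. \<forall>g\<in>carrier G. \<forall>t. u (g \<otimes> y t) = u g \<and> u (g \<otimes> z t) = u g \<and>
     fc (g \<otimes> a t) + u (g \<otimes> a t) = fc g + u g)"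

definition left_inv :: "'a set \<Rightarrow> ('a \<Rightarrow> bit) \<Rightarrow> bool" where
  "left_inv H f \<longleftrightarrow> (\<forall>h\<in>H. \<forall>g\<in>carrier G. f (h \<otimes> g) = f g)"

text \<open>The aim is \<open>good {\<one>}\<close>, where left invariance is no restriction. It is
  reached by passing from larger subgroups of \<open>Q\<close> to smaller ones.\<close>

definition good :: "'a set \<Rightarrow> bool" where
  "good H \<longleftrightarrow> (\<forall>fb fc. cocycle fb fc \<and> left_inv H fb \<and> left_inv H fc \<longrightarrow> split fc)"

text \<open>For \<open>w\<close> with fifth power \<open>\<one>\<close> this is an average over the
  powers of \<open>w\<close>, because 5 is 1 modulo 2.\<close>

definition avg :: "'a \<Rightarrow> ('a \<Rightarrow> bit) \<Rightarrow> 'a \<Rightarrow> bit" where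
  "avg w f g = (\<Sum>i<5. f (w [^] (i::nat) \<otimes> g))"

text \<open>The graph on \<open>S H\<close> with the moves by \<open>y\<close> and \<open>z\<close>
  as edges is connected, phrased through Boolean functions that are constant along edges. Moves by
  \<open>y\<close> never cross the boundary of \<open>S H\<close>, so for them all of
  \<open>B\<close> can be allowed.\<close>

definition connected :: "'a set \<Rightarrow> bool" where
  "connected H \<longleftrightarrow> (\<forall>\<Phi> :: 'a \<Rightarrow> bool. (\<forall>g\<in>B. \<forall>t. \<Phi> (g \<otimes> y t) = \<Phi> g) \<longrightarrow>
     (\<forall>g\<in>S H. \<forall>t. g \<otimes> z t \<in> S H \<longrightarrow> \<Phi> (g \<otimes> z t) = \<Phi> g) \<longrightarrow> (\<forall>g\<in>S H. \<forall>h\<in>S H. \<Phi> g = \<Phi> h))"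

lemma split_add:
  assumes "split f" "split f'" shows "split (\<lambda>g. f g + f' g)"
proof -
  from assms obtain u u' where u:
    "\<forall>g\<in>carrier G. \<forall>t. u (g \<otimes> y t) = u g \<and> u (g \<otimes> z t) = u g \<and> f (g \<otimes> a t) + u (g \<otimes> a t) = f g + u g"
    "\<forall>g\<in>carrier G. \<forall>t. u' (g \<otimes> y t) = u' g \<and> u' (g \<otimes> z t) = u' g \<and> f' (g \<otimes> a t) + u' (g \<otimes> a t) = f' g + u' g"
    unfolding split_def by blast
  have swap: "(p + p') + (q + q') = (p + q) + (p' + q')" for p p' q q' :: bit
    by (simp only: ac_simps)
  have "(f (g \<otimes> a t) + f' (g \<otimes> a t)) + (u (g \<otimes> a t) + u' (g \<otimes> a t)) = (f g + f' g) + (u g + u' g)"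
    if "g \<in> carrier G" for g t
  proof -
    have "f (g \<otimes> a t) + u (g \<otimes> a t) = f g + u g" "f' (g \<otimes> a t) + u' (g \<otimes> a t) = f' g + u' g"
      using u that by blast+
    then show ?thesis by (subst swap, subst (2) swap) (simp only:)
  qed
  with u show ?thesis
    unfolding split_def by (intro exI[of _ "\<lambda>g. u g + u' g"]) simp
qed

lemma split_zero: "split (\<lambda>_. 0)"
  unfolding split_def by (intro exI[of _ "\<lambda>_. 0"]) simp

lemma split_sum:
  assumes "\<And>i. i \<in> I \<Longrightarrow> split (f i)" shows "split (\<lambda>g. \<Sum>i\<in>I. f i g)"
  using assms
proof (induction I rule: infinite_finite_induct)
  case (insert i I)
  then show ?case using split_add[of "f i" "\<lambda>g. \<Sum>i\<in>I. f i g"] by simp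
qed (simp_all add: split_zero)

lemma split_cong:
  assumes "\<And>g. g \<in> carrier G \<Longrightarrow> f g = f' g" shows "split f \<longleftrightarrow> split f'"
  using assms unfolding split_def by simp

lemma left_inv_mono: "left_inv K f \<Longrightarrow> H \<subseteq> K \<Longrightarrow> left_inv H f"
  unfolding left_inv_def by blast

lemma left_inv_generate:
  assumes "left_inv H f" and H: "H \<subseteq> carrier G"
  shows "left_inv (generate G H) f"
proof -
  have "\<forall>g\<in>carrier G. f (h \<otimes> g) = f g" if "h \<in> generate G H" for h
    using that
  proof (induction rule: generate.induct)
    case (inv h)
    then have h: "h \<in> carrier G" using H by blast
    have "f (inv h \<otimes> g) = f g" if g: "g \<in> carrier G" for g
    proof -
      have "f (h \<otimes> (inv h \<otimes> g)) = f (inv h \<otimes> g)"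
        using assms(1) inv h g by (simp add: left_inv_def)
      moreover have "h \<otimes> (inv h \<otimes> g) = g" using h g by (simp flip: m_assoc)
      ultimately show ?thesis by simp
    qed
    then show ?case by blast
  next
    case (eng h1 h2)
    then show ?case using generate_in_carrier[OF H] by (simp add: m_assoc)
  qed (use assms in \<open>auto simp: left_inv_def\<close>)
  then show ?thesis by (simp add: left_inv_def)
qed

text \<open>Averaging uses left translations, which commute with the right multiplications in
  \<open>cocycle\<close>.\<close>

lemma cocycle_avg:
  assumes w: "w \<in> carrier G" and c: "cocycle fb fc"
  shows "cocycle (avg w fb) (avg w fc)"
proof -
  have *: "w [^] i \<otimes> (g \<otimes> x) = w [^] i \<otimes> g \<otimes> x" if "g \<in> carrier G" "x \<in> carrier G" for g x and i :: nat
    using that w by (simp add: m_assoc)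
  show ?thesis
    using c w unfolding cocycle_def avg_def by (simp add: * flip: sum.distrib)
qed

text \<open>Translation by \<open>w\<close> shifts the summation index cyclically since the fifth
  power of \<open>w\<close> is \<open>\<one>\<close>. Invariance under \<open>H\<close> survives
  because \<open>Q\<close> is abelian.\<close>

lemma left_inv_avg:
  assumes w: "w \<in> Q" and H: "H \<subseteq> Q" and f: "left_inv H f"
  shows "left_inv (insert w H) (avg w f)"
proof -
  have [simp]: "w \<in> carrier G" using w by (rule Q_closed)
  have w5: "w [^] (5::nat) = \<one>" using ker_exp w by (simp add: Q_def)
  have "avg w f (w \<otimes> g) = avg w f g" if g: "g \<in> carrier G" for g
  proof -
    have "avg w f (w \<otimes> g) = (\<Sum>i<5. f (w [^] Suc i \<otimes> g))"
      using g by (simp add: avg_def m_assoc)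
    also have "\<dots> = (\<Sum>i<4. f (w [^] Suc i \<otimes> g)) + f (w [^] (5::nat) \<otimes> g)"
      by (simp add: eval_nat_numeral)
    also have "\<dots> = f (w [^] (0::nat) \<otimes> g) + (\<Sum>i<4. f (w [^] Suc i \<otimes> g))"
      using w5 by (simp add: add.commute)
    also have "\<dots> = (\<Sum>i<Suc 4. f (w [^] i \<otimes> g))"
      by (rule sum.lessThan_Suc_shift[symmetric])
    finally show ?thesis by (simp add: avg_def)
  qed
  moreover have "avg w f (h \<otimes> g) = avg w f g" if h: "h \<in> H" and g: "g \<in> carrier G" for h g
  proof -
    have [simp]: "h \<in> carrier G" using h H Q_closed by blast
    have "w [^] i \<otimes> (h \<otimes> g) = h \<otimes> (w [^] i \<otimes> g)" for i :: nat
    proof -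
      have "w \<otimes> h = h \<otimes> w" using Q_comm w h H by blast
      then have "w [^] i \<otimes> h = h \<otimes> w [^] i" by (simp add: pow_mult_distrib group_commutes_pow)
      then show ?thesis using g by (simp flip: m_assoc)
    qed
    then show ?thesis using f h g by (simp add: avg_def left_inv_def)
  qed
  ultimately show ?thesis unfolding left_inv_def by blast
qed

text \<open>
  In \<open>\<int>\<^sub>5 \<times> \<int>\<^sub>5\<close> every nonzero element lies on exactly one of the six lines, hence modulo \<open>2\<close> the
  identity is the sum of the averages over the lines and over the whole group.
\<close>

lemma good_step:
  assumes u: "u \<in> Q" and v: "v \<in> Q" and H: "H \<subseteq> Q"
    and good_u: "good (generate G (insert u H))"
    and good_v: "\<And>s::nat. good (generate G (insert (v \<otimes> u [^] s) H))"
  shows "good H"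
  unfolding good_def
proof (intro allI impI, elim conjE)
  fix fb fc assume f: "cocycle fb fc" "left_inv H fb" "left_inv H fc"
  have [simp]: "u \<in> carrier G" "v \<in> carrier G" using u v Q_closed by auto
  have pow_Q: "w [^] s \<in> Q" if "w \<in> Q" for w and s :: nat
    using Q_subgroup that by (induction s) (auto intro: subgroup.one_closed subgroup.m_closed)
  have split_avg: "split (avg w fc')"
    if w: "w \<in> Q" and good: "good (generate G (insert w H))"
      and f: "cocycle fb' fc'" "left_inv H fb'" "left_inv H fc'" for w fb' fc'
  proof -
    have "insert w H \<subseteq> carrier G" using w H Q_closed by blast
    then have "left_inv (generate G (insert w H)) (avg w fb')" "left_inv (generate G (insert w H)) (avg w fc')"
      using left_inv_generate left_inv_avg[OF w H] f by blast+
    moreover have "cocycle (avg w fb') (avg w fc')"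
      using cocycle_avg w f(1) Q_closed by blast
    ultimately show ?thesis using good unfolding good_def by blast
  qed
  have vu: "v \<otimes> u [^] s \<in> Q" for s :: nat
    using Q_subgroup v pow_Q[OF u] by (simp add: subgroup.m_closed)
  have 1: "split (\<lambda>g. \<Sum>s<5. avg (v \<otimes> u [^] (s::nat)) fc g)"
    by (rule split_sum) (rule split_avg[OF vu good_v f])
  have 2: "split (avg u fc)" by (rule split_avg[OF u good_u f])
  have "left_inv H (avg v f)" if "left_inv H f" for f
    using left_inv_avg[OF v H that] left_inv_mono by blast
  \<comment> \<open>The average over the plane is taken in two stages: the averages along
    \<open>v\<close> form a cocycle that is still invariant under \<open>H\<close>, and this is
    averaged along \<open>u\<close>.\<close>
  then have 3: "split (avg u (avg v fc))"
    using f cocycle_avg by (intro split_avg[OF u good_u, of "avg v fb" "avg v fc"]) auto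
  have "fc g = (\<Sum>s<5. avg (v \<otimes> u [^] (s::nat)) fc g) + (avg u fc g + avg u (avg v fc) g)"
    if g: "g \<in> carrier G" for g
  proof -
    let ?F = "\<lambda>i j. fc (v [^] (i::nat) \<otimes> u [^] (j::nat) \<otimes> g)"
    have comm: "v \<otimes> u [^] j = u [^] j \<otimes> v" for j :: nat using Q_comm v pow_Q[OF u] by blast
    have "u [^] (5::nat) = \<one>" using ker_exp u by (simp add: Q_def)
    then have mod: "u [^] (n mod 5) = u [^] n" for n :: nat
      by (metis \<open>u \<in> carrier G\<close> mult_div_mod_eq nat_pow_closed nat_pow_mult nat_pow_one nat_pow_pow l_one)
    \<comment> \<open>The powers of \<open>v \<otimes> u [^] s\<close> are the points of the line of
      slope \<open>s\<close>; exponents of \<open>u\<close> are reduced modulo 5 to match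
      \<open>bit_sum_identity\<close>.\<close>
    have "(v \<otimes> u [^] s) [^] i = v [^] i \<otimes> u [^] ((s * i) mod 5)" for s i :: nat
      using pow_mult_distrib[OF comm[of s]] by (simp add: nat_pow_pow mod)
    moreover have "v [^] i \<otimes> (u [^] j \<otimes> g) = v [^] i \<otimes> u [^] j \<otimes> g" for i j :: nat
      using g by (simp add: m_assoc)
    ultimately show ?thesis
      using bit_sum_identity[of ?F] g by (simp add: avg_def)
  qed
  then show "split fc"
    using split_add[OF 1 split_add[OF 2 3]] split_cong by (metis (no_types, lifting))
qed

text \<open>\<open>g\<close> and \<open>D g\<close> differ by a factor from \<open>Q\<close>, which
  centralises \<open>Q\<close> and hence the conjugates of \<open>a t\<close>.\<close>

lemma conj_D:
  assumes [simp]: "g \<in> carrier G"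
  shows "g \<otimes> a t \<otimes> inv g = D g \<otimes> a t \<otimes> inv (D g)"
proof -
  let ?q = "g \<otimes> inv (D g)" and ?d = "D g \<otimes> a t \<otimes> inv (D g)"
  have [simp]: "D g \<in> carrier G" by (simp add: D_closed)
  have "?q \<otimes> ?d = ?d \<otimes> ?q" by (intro Q_comm Q_part Q_conj) auto
  moreover have "?q \<otimes> ?d = g \<otimes> a t \<otimes> inv (D g)"
    by (simp add: m_assoc flip: m_assoc[of "inv (D g)" "D g"])
  ultimately have "g \<otimes> a t \<otimes> inv (D g) = ?d \<otimes> g \<otimes> inv (D g)" by (simp add: m_assoc)
  then have "g \<otimes> a t = ?d \<otimes> g" by simp
  then have "g \<otimes> a t \<otimes> inv g = ?d \<otimes> g \<otimes> inv g" by (simp only:)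
  then show ?thesis by (simp add: m_assoc)
qed

lemma conj_a_in_H:
  assumes H: "subgroup H G" and g: "g \<in> B" "g \<notin> S H"
  shows "g \<otimes> a t \<otimes> inv g \<in> H"
  using one_param_subgroup[OF conj_one_param[OF hom_a] H prime_k, of g 1 t] g B_closed[of g]
  by (simp add: S_def)

text \<open>Right multiplication of \<open>g\<close> by \<open>a t\<close> is left multiplication by
  a conjugate of \<open>a t\<close>, which lies in \<open>H\<close> here.\<close>

lemma left_inv_a:
  assumes H: "subgroup H G" and f: "left_inv H f" and g: "g \<in> carrier G" "D g \<notin> S H"
  shows "f (g \<otimes> a t) = f g"
proof -
  have "g \<otimes> a t \<otimes> inv g \<in> H"
    using conj_a_in_H[OF H D_in_B g(2)] g(1) conj_D by simp
  then have "f (g \<otimes> a t \<otimes> inv g \<otimes> g) = f g" using f g(1) unfolding left_inv_def by blast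
  then show ?thesis using g(1) by (simp add: m_assoc)
qed

text \<open>This is for the function \<open>fb + fc\<close>. Its right invariance under
  \<open>a\<close> is left invariance at \<open>g\<close> under the conjugate of \<open>a 1\<close>,
  which generates \<open>Q\<close> together with \<open>H\<close>.\<close>

lemma left_inv_a_sum:
  assumes H: "subgroup H G" "H \<subseteq> Q" and f: "left_inv H f"
    and fa: "\<And>g t. g \<in> carrier G \<Longrightarrow> f (g \<otimes> a t) = f g"
    and g: "g \<in> carrier G" "Q \<subseteq> generate G (insert (g \<otimes> a 1 \<otimes> inv g) H)" and q: "q \<in> Q"
  shows "f (q \<otimes> g) = f g"
proof -
  \<comment> \<open>All translates \<open>p \<otimes> g\<close> are included, as invariance at
    \<open>g\<close> alone would not be stable under products.\<close>
  let ?K = "{q \<in> Q. \<forall>p\<in>Q. f (q \<otimes> p \<otimes> g) = f (p \<otimes> g)}"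
  have Q_one: "\<one> \<in> Q" and Q_inv: "\<And>q. q \<in> Q \<Longrightarrow> inv q \<in> Q"
    and Q_mult: "\<And>q q'. q \<in> Q \<Longrightarrow> q' \<in> Q \<Longrightarrow> q \<otimes> q' \<in> Q"
    using subgroup.one_closed[OF Q_subgroup] subgroup.m_inv_closed[OF Q_subgroup] subgroup.m_closed[OF Q_subgroup]
    by blast+
  have "subgroup ?K G"
  proof (rule subgroupI)
    have "\<one> \<in> ?K" using Q_one Q_closed by simp
    then show "?K \<noteq> {}" by blast
  next
    fix q assume q: "q \<in> ?K"
    then have qQ: "q \<in> Q" by blast
    have "f (inv q \<otimes> p \<otimes> g) = f (p \<otimes> g)" if p: "p \<in> Q" for p
    proof -
      have "f (q \<otimes> (inv q \<otimes> p) \<otimes> g) = f (inv q \<otimes> p \<otimes> g)"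
        using q Q_mult[OF Q_inv[OF qQ] p] by blast
      moreover have "q \<otimes> (inv q \<otimes> p) = p"
        using qQ p Q_closed by (simp flip: m_assoc)
      ultimately show ?thesis by (simp only:)
    qed
    then show "inv q \<in> ?K" using Q_inv[OF qQ] by blast
  next
    fix q q' assume q: "q \<in> ?K" "q' \<in> ?K"
    then have qQ: "q \<in> Q" "q' \<in> Q" by blast+
    have "f (q \<otimes> q' \<otimes> p \<otimes> g) = f (p \<otimes> g)" if p: "p \<in> Q" for p
    proof -
      have "f (q \<otimes> (q' \<otimes> p) \<otimes> g) = f (q' \<otimes> p \<otimes> g)" using q(1) Q_mult[OF qQ(2) p] by blast
      also have "\<dots> = f (p \<otimes> g)" using q(2) p by blast
      also have "q \<otimes> (q' \<otimes> p) = q \<otimes> q' \<otimes> p"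
        using qQ p Q_closed by (simp add: m_assoc)
      finally show ?thesis .
    qed
    then show "q \<otimes> q' \<in> ?K" using Q_mult[OF qQ] by blast
  qed (use Q_closed in blast)
  moreover have "insert (g \<otimes> a 1 \<otimes> inv g) H \<subseteq> ?K"
  proof -
    have "f (g \<otimes> a 1 \<otimes> inv g \<otimes> p \<otimes> g) = f (p \<otimes> g)" if p: "p \<in> Q" for p
    proof -
      have "g \<otimes> a 1 \<otimes> inv g \<otimes> p = p \<otimes> (g \<otimes> a 1 \<otimes> inv g)"
        using p g(1) by (intro Q_comm Q_conj) auto
      then have "g \<otimes> a 1 \<otimes> inv g \<otimes> p \<otimes> g = p \<otimes> g \<otimes> a 1"
        using p g(1) Q_closed by (simp add: m_assoc)
      then show ?thesis using fa p g(1) Q_closed by simp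
    qed
    moreover have "f (h \<otimes> p \<otimes> g) = f (p \<otimes> g)" if "h \<in> H" "p \<in> Q" for h p
      using f that g(1) H(2) Q_closed unfolding left_inv_def by (metis in_mono m_assoc m_closed)
    ultimately show ?thesis using H(2) Q_conj[of "a 1" g] g(1) by auto
  qed
  ultimately have "generate G (insert (g \<otimes> a 1 \<otimes> inv g) H) \<subseteq> ?K" by (rule generate_subgroup_incl[rotated])
  then have "Q \<subseteq> ?K" using g(2) by (rule order_trans[rotated])
  then have "f (q \<otimes> \<one> \<otimes> g) = f (\<one> \<otimes> g)" using q Q_one by blast
  then show ?thesis using q g(1) Q_closed by simp
qed

text \<open>Differences of \<open>fc\<close> along \<open>Q\<close> are compared at different points
  of \<open>S H\<close>: moves by \<open>y\<close> preserve them, and so do moves by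
  \<open>z\<close> because they are also differences of \<open>fb\<close>. The common difference is
  the splitting function.\<close>

lemma good_cyclic:
  assumes H: "subgroup H G" "H \<subseteq> Q" and conn: "connected H"
    and cyc: "\<And>g. g \<in> S H \<Longrightarrow> Q \<subseteq> generate G (insert (g \<otimes> a 1 \<otimes> inv g) H)"
  shows "good H"
  unfolding good_def
proof (intro allI impI, elim conjE)
  fix fb fc assume f: "cocycle fb fc" "left_inv H fb" "left_inv H fc"
  show "split fc"
  proof (cases "S H = {}")
    case True
    \<comment> \<open>Here \<open>fc\<close> is already invariant under \<open>a\<close>, so
      \<open>u = 0\<close> splits it.\<close>
    then show ?thesis
      unfolding split_def using left_inv_a[OF H(1) f(3)] by (intro exI[of _ "\<lambda>_. 0"]) simp
  next
    case False
    then obtain g0 where g0: "g0 \<in> S H" by blast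
    define E where "E g q = fc g + fc (q \<otimes> g)" for g q
    have SB: "g \<in> B" "g \<in> carrier G" if "g \<in> S H" for g
      using that B_closed by (auto simp: S_def)
    have E_fb: "E g q = fb g + fb (q \<otimes> g)" if g: "g \<in> S H" and q: "q \<in> Q" for g q
    proof -
      have "fb (q \<otimes> g) + fc (q \<otimes> g) = fb g + fc g"
        using left_inv_a_sum[where f = "\<lambda>g. fb g + fc g", OF H _ _ SB(2)[OF g] cyc[OF g] q] f
        by (simp add: cocycle_def left_inv_def)
      then show ?thesis unfolding E_def
        by (metis (no_types, opaque_lifting) add.commute add.left_commute bit_add_self_left)
    qed
    have const: "E g q = E g0 q" if g: "g \<in> S H" and q: "q \<in> Q" for g q
    proof -
      let ?\<Phi> = "\<lambda>g. E g q = E g0 q"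
      have [simp]: "q \<in> carrier G" using q by (rule Q_closed)
      have "E (g \<otimes> y t) q = E g q" if "g \<in> B" for g t
        using f(1) B_closed[OF that] by (simp add: E_def cocycle_def flip: m_assoc)
      moreover have "E (g \<otimes> z t) q = E g q" if "g \<in> S H" "g \<otimes> z t \<in> S H" for g t
        using that q f(1) SB(2) by (simp add: E_fb cocycle_def flip: m_assoc)
      ultimately have "?\<Phi> g = ?\<Phi> g0"
        using conn[unfolded connected_def, rule_format, of ?\<Phi> g g0] g g0 by simp
      then show ?thesis by simp
    qed
    \<comment> \<open>The \<open>Q\<close>-component of \<open>g\<close> is moved to the base point
      \<open>g0\<close>. It does not change under right multiplication by elements of
      \<open>B\<close>, so neither does \<open>u\<close>.\<close>
    define u where "u g = E g0 (g \<otimes> inv (D g))" for g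
    have Dc [simp]: "D g \<in> carrier G" if "g \<in> carrier G" for g using that by (rule D_closed)
    have cancel: "g \<otimes> x \<otimes> inv (D g \<otimes> x) = g \<otimes> inv (D g)" if "g \<in> carrier G" "x \<in> carrier G" for g x
      using that by (simp add: inv_mult_group m_assoc flip: m_assoc[of x "inv x"])
    have "u (g \<otimes> y t) = u g" "u (g \<otimes> z t) = u g" if "g \<in> carrier G" for g t
      using that by (simp_all add: u_def D_mult D_y D_z cancel)
    moreover have "fc (g \<otimes> a t) + u (g \<otimes> a t) = fc g + u g" if g: "g \<in> carrier G" for g t
    proof -
      have D: "D (g \<otimes> a t) = D g" using g by (simp add: D_mult D_a)
      show ?thesis
      proof (cases "D g \<in> S H")
        case True
        \<comment> \<open>By constancy the base point can be replaced by \<open>D g\<close>. Hence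
          \<open>fc + u\<close> depends on \<open>D g\<close> only, and \<open>a\<close> does not
          change \<open>D g\<close>.\<close>
        have "u g = fc (D g) + fc g" if "g \<in> carrier G" "D g \<in> S H" for g
          using const[OF that(2) Q_part[OF that(1)]] that(1) by (simp add: u_def E_def m_assoc)
        from this[of g] this[of "g \<otimes> a t"] show ?thesis using g True D by (simp add: ac_simps)
      next
        case False
        \<comment> \<open>Outside \<open>S H\<close>, multiplication by \<open>a t\<close> changes
          the \<open>Q\<close>-component by an element of \<open>H\<close>, which affects neither
          \<open>u\<close> nor \<open>fc\<close>.\<close>
        have d: "g \<otimes> a t \<otimes> inv g \<in> H"
          using conj_a_in_H[OF H(1) D_in_B False] g conj_D by simp
        have "g \<otimes> a t \<otimes> inv (D g) = g \<otimes> a t \<otimes> inv g \<otimes> (g \<otimes> inv (D g))"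
          using g by (simp add: m_assoc flip: m_assoc[of "inv g" g])
        moreover have "fc (g \<otimes> a t \<otimes> inv g \<otimes> (g \<otimes> inv (D g)) \<otimes> g0) = fc (g \<otimes> inv (D g) \<otimes> g0)"
          using f(3) d g SB(2)[OF g0] unfolding left_inv_def
          by (metis Dc inv_closed m_assoc m_closed closed(1))
        ultimately have "u (g \<otimes> a t) = u g" by (simp add: u_def E_def D)
        then show ?thesis using left_inv_a[OF H(1) f(3) g False] by simp
      qed
    qed
    ultimately show ?thesis unfolding split_def by blast
  qed
qed

text \<open>Downward induction on \<open>H\<close>. If some \<open>u\<close> outside
  \<open>H\<close> does not generate \<open>Q\<close> together with \<open>H\<close>, a further
  \<open>v\<close> spans with \<open>u\<close> a plane modulo \<open>H\<close>, and
  \<open>good_step\<close> reduces to larger subgroups. Otherwise \<open>Q\<close> modulo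
  \<open>H\<close> has order 1 or 5, the case of \<open>good_cyclic\<close>.\<close>

lemma good_subgroup:
  assumes conn: "\<And>H. subgroup H G \<Longrightarrow> H \<subseteq> Q \<Longrightarrow> connected H"
  shows "subgroup H G \<Longrightarrow> H \<subseteq> Q \<Longrightarrow> good H"
proof (induction "card Q - card H" arbitrary: H rule: less_induct)
  case less
  note H = \<open>subgroup H G\<close> \<open>H \<subseteq> Q\<close>
  have fin_Q: "finite Q" using fin by (rule rev_finite_subset) (auto dest: Q_closed)
  have good: "good (generate G (insert w H))" if w: "w \<in> Q" "w \<notin> H" for w
  proof (rule less.hyps)
    have sub: "insert w H \<subseteq> carrier G" using w H Q_closed by blast
    show "subgroup (generate G (insert w H)) G" by (rule generate_is_subgroup[OF sub])
    show le: "generate G (insert w H) \<subseteq> Q"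
      by (rule generate_subgroup_incl) (use w H Q_subgroup in auto)
    have "H \<subset> generate G (insert w H)" using w by (blast intro: generate.incl)
    then have "card H < card (generate G (insert w H))"
      using le fin_Q by (meson finite_subset psubset_card_mono)
    moreover have "card (generate G (insert w H)) \<le> card Q" using le fin_Q by (rule card_mono[rotated])
    ultimately show "card Q - card (generate G (insert w H)) < card Q - card H" by linarith
  qed
  show "good H"
  proof (cases "\<exists>u\<in>Q - H. \<not> Q \<subseteq> generate G (insert u H)")
    case True
    then obtain u v where uv: "u \<in> Q" "u \<notin> H" "v \<in> Q" "v \<notin> generate G (insert u H)" by blast
    have [simp]: "u \<in> carrier G" "v \<in> carrier G" using uv Q_closed by auto
    have gen: "subgroup (generate G (insert u H)) G"
      by (rule generate_is_subgroup) (use uv H Q_closed in blast)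
    have pow: "u [^] (s::nat) \<in> generate G (insert u H)" for s
      by (induction s) (auto intro: generate.one generate.eng generate.incl)
    have "v \<otimes> u [^] (s::nat) \<notin> H" for s
    proof
      assume "v \<otimes> u [^] s \<in> H"
      then have "v \<otimes> u [^] s \<in> generate G (insert u H)" by (blast intro: generate.incl)
      then have "v \<otimes> u [^] s \<otimes> inv (u [^] s) \<in> generate G (insert u H)"
        using pow[of s] gen by (metis subgroup.m_closed subgroup.m_inv_closed)
      then show False using uv by (simp add: m_assoc)
    qed
    moreover have "v \<otimes> u [^] (s::nat) \<in> Q" for s
      using uv Q_subgroup by (induction s) (auto simp: subgroup.m_closed simp flip: m_assoc)
    ultimately show ?thesis using good_step[OF uv(1,3) H(2)] good uv by blast
  next
    case False
    show ?thesis
    proof (rule good_cyclic[OF H conn[OF H]])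
      fix g assume "g \<in> S H"
      then have "g \<otimes> a 1 \<otimes> inv g \<in> Q - H"
        using Q_conj[of "a 1" g] B_closed[of g] by (auto simp: S_def)
      then show "Q \<subseteq> generate G (insert (g \<otimes> a 1 \<otimes> inv g) H)" using False by blast
    qed
  qed
qed

theorem cocycle_split:
  assumes "\<And>H. subgroup H G \<Longrightarrow> H \<subseteq> Q \<Longrightarrow> connected H" and "cocycle fb fc"
  shows "split fc"
proof -
  have "good {\<one>}"
    using good_subgroup[OF assms(1)] triv_subgroup Q_subgroup subgroup.one_closed by blast
  then show ?thesis using assms(2) by (simp add: good_def left_inv_def)
qed

end

section \<open>Connectedness of \<open>S H\<close> for two kinds of groups \<open>B\<close>\<close>

lemma avoid_three:
  assumes "CARD('k::finite) > 3"
  shows "\<exists>x :: 'k. x \<noteq> u \<and> x \<noteq> v \<and> x \<noteq> w"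
proof -
  have "card {u, v, w} \<le> 3" by (simp add: card_insert_if)
  then have "{u, v, w} \<noteq> (UNIV :: 'k set)" using assms by force
  then show ?thesis by blast
qed

lemma two_neq_0:
  assumes "CARD('k::{field,finite}) = 5" shows "(2 :: 'k) \<noteq> 0"
proof
  assume "(2 :: 'k) = 0"
  then have "(of_nat 2 :: 'k) = 0" by simp
  then have "CHAR('k) dvd 2" by (simp only: of_nat_eq_0_iff_char_dvd)
  then have "CHAR('k) dvd 2 * 2" by (rule dvd_mult)
  moreover have "CHAR('k) dvd 5" using CHAR_dvd_CARD[where 'a = 'k] assms by simp
  ultimately have "CHAR('k) dvd 5 - 2 * 2" by (rule dvd_diff_nat[rotated])
  then show False by simp
qed

context amalgam
begin

text \<open>Right multiplication by \<open>w s t\<close> is a move by \<open>y\<close>, one by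
  \<open>z\<close> and one by \<open>y\<close> back. As moves by \<open>y\<close> are free, each
  \<open>s\<close> yields a further direction of lines that behave like those of
  \<open>z\<close>.\<close>

definition w :: "'k \<Rightarrow> 'k \<Rightarrow> 'a" where
  "w s t = y s \<otimes> z t \<otimes> y (- s)"

lemma one_param_w: "one_param (w s)"
  unfolding w_def using conj_one_param[OF hom_z closed(2)[of s]] by (simp add: one_param_inv[OF hom_y])

lemma w_in_B [simp]: "w s t \<in> B"
  by (simp add: w_def y_in_B B_mult')

lemma w_closed [simp]: "w s t \<in> carrier G"
  by (simp add: B_closed)

lemma w_0 [simp]: "w 0 t = z t"
  by (simp add: w_def one_param_0[OF hom_y])

lemma y_z: "y s \<otimes> z t = w s t \<otimes> y s"
  using one_param_add[OF hom_y, of "- s" s] by (simp add: w_def m_assoc one_param_0[OF hom_y])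

lemma mult_w: "g \<in> carrier G \<Longrightarrow> g \<otimes> w s t = g \<otimes> y s \<otimes> z t \<otimes> y (- s)"
  by (simp add: w_def m_assoc)

lemma S_w_iff: "g \<in> B \<Longrightarrow> g \<otimes> w s t \<in> S H \<longleftrightarrow> g \<otimes> y s \<otimes> z t \<in> S H"
  by (simp add: mult_w S_y_iff B_closed)

lemma thick_S_w:
  assumes "subgroup H G" "g \<in> B" shows "thick (\<lambda>t. g \<otimes> w s t \<in> S H)"
  using thick_S[OF assms(1), of "g \<otimes> y s"] assms(2) by (simp add: S_w_iff)

lemma const_w:
  assumes y: "\<forall>g\<in>B. \<forall>t. \<Phi> (g \<otimes> y t) = \<Phi> g"
    and z: "\<forall>g\<in>S H. \<forall>t. g \<otimes> z t \<in> S H \<longrightarrow> \<Phi> (g \<otimes> z t) = \<Phi> g"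
    and g: "g \<in> B" and "g \<otimes> w s t \<in> S H" "g \<otimes> w s t' \<in> S H"
  shows "\<Phi> (g \<otimes> w s t) = \<Phi> (g \<otimes> w s t')"
proof -
  have [simp]: "g \<in> carrier G" using g by (rule B_closed)
  have *: "\<Phi> (g \<otimes> w s t) = \<Phi> (g \<otimes> y s \<otimes> z t)" for t
    using y g by (simp add: mult_w)
  have "g \<otimes> y s \<otimes> z t \<otimes> z (t' - t) = g \<otimes> y s \<otimes> z t'"
    using one_param_add[OF hom_z, of t "t' - t"] by (simp add: m_assoc)
  then show ?thesis
    using z[rule_format, of "g \<otimes> y s \<otimes> z t" "t' - t"] assms(4,5) g by (simp add: * S_w_iff)
qed

text \<open>The three commuting directions \<open>w 0\<close>, \<open>w 1\<close> and
  \<open>w (- 1)\<close> act as the coordinates of a cube, and every element of \<open>B\<close> is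
  a point of it times some \<open>y s\<close>. So \<open>cube_connected\<close> applies.\<close>

lemma connected_abelian:
  assumes comm: "\<And>s t s' t'. w s t \<otimes> w s' t' = w s' t' \<otimes> w s t"
    and span: "\<And>s t. \<exists>t0 t1 t2. w s t = w 0 t0 \<otimes> w 1 t1 \<otimes> w (- 1) t2"
    and H: "subgroup H G"
  shows "connected H"
  unfolding connected_def
proof (intro allI impI ballI)
  fix \<Phi> :: "'a \<Rightarrow> bool" and g h
  assume \<Phi>: "\<forall>g\<in>B. \<forall>t. \<Phi> (g \<otimes> y t) = \<Phi> g"
    "\<forall>g\<in>S H. \<forall>t. g \<otimes> z t \<in> S H \<longrightarrow> \<Phi> (g \<otimes> z t) = \<Phi> g"
    and gh: "g \<in> S H" "h \<in> S H"
  define pt where "pt t0 t1 t2 = w 0 t0 \<otimes> w 1 t1 \<otimes> w (- 1) t2" for t0 t1 t2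
  have pt_B: "pt t0 t1 t2 \<in> B" for t0 t1 t2 by (simp add: pt_def B_mult' del: w_0)
  then have [simp]: "pt t0 t1 t2 \<in> carrier G" for t0 t1 t2 by (rule B_closed)
  have lcomm: "w s t \<otimes> (w s' t' \<otimes> g) = w s' t' \<otimes> (w s t \<otimes> g)" if "g \<in> carrier G" for s t s' t' g
    using that comm[of s t s' t'] m_assoc w_closed by metis
  have pt_mult: "pt t0 t1 t2 \<otimes> pt u0 u1 u2 = pt (t0 + u0) (t1 + u1) (t2 + u2)" for t0 t1 t2 u0 u1 u2
  proof -
    have "pt (t0 + u0) (t1 + u1) (t2 + u2) = (w 0 t0 \<otimes> w 0 u0) \<otimes> (w 1 t1 \<otimes> w 1 u1) \<otimes> (w (- 1) t2 \<otimes> w (- 1) u2)"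
      by (simp only: pt_def one_param_add[OF one_param_w])
    also have "\<dots> = pt t0 t1 t2 \<otimes> pt u0 u1 u2"
      unfolding pt_def by (simp only: m_assoc w_closed m_closed comm lcomm)
    finally show ?thesis by simp
  qed
  have repr: "\<exists>t0 t1 t2 s. g = pt t0 t1 t2 \<otimes> y s" if "g \<in> B" for g
    using that
  proof (induction rule: B_induct)
    case one
    have "\<one> = pt 0 0 0 \<otimes> y 0" by (simp add: pt_def one_param_0[OF one_param_w] one_param_0[OF hom_y] del: w_0)
    then show ?case by blast
  next
    case (y g t)
    then obtain t0 t1 t2 s where "g = pt t0 t1 t2 \<otimes> y s" by blast
    then have "g \<otimes> y t = pt t0 t1 t2 \<otimes> y (s + t)" by (simp add: m_assoc one_param_add[OF hom_y])
    then show ?case by blast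
  next
    case (z g t)
    then obtain t0 t1 t2 s where "g = pt t0 t1 t2 \<otimes> y s" by blast
    moreover obtain u0 u1 u2 where "w s t = pt u0 u1 u2" using span unfolding pt_def by blast
    ultimately have "g \<otimes> z t = pt t0 t1 t2 \<otimes> pt u0 u1 u2 \<otimes> y s" by (simp add: m_assoc y_z)
    then show ?case unfolding pt_mult by blast
  qed
  let ?P = "\<lambda>t0 t1 t2. pt t0 t1 t2 \<in> S H"
  \<comment> \<open>The coordinate to be varied is brought to the last factor, since lines arise by
    right multiplication.\<close>
  have pt0: "pt t0 t1 t2 = w 1 t1 \<otimes> w (- 1) t2 \<otimes> w 0 t0"
    and pt1: "pt t0 t1 t2 = w 0 t0 \<otimes> w (- 1) t2 \<otimes> w 1 t1" for t0 t1 t2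
    unfolding pt_def by (simp_all only: m_assoc w_closed m_closed comm lcomm)
  have in_B: "w s t \<otimes> w s' t' \<in> B" for s t s' t' by (simp add: B_mult')
  have const: "\<Phi> (pt t0 t1 t2) = \<Phi> (pt u0 u1 u2)" if "?P t0 t1 t2" "?P u0 u1 u2" for t0 t1 t2 u0 u1 u2
  proof (rule cube_connected[where P = ?P and f = "\<lambda>t0 t1 t2. \<Phi> (pt t0 t1 t2)", OF _ _ _ _ _ _ that])
    show "CARD('k) > 2" by (simp add: card_k)
    show "thick (\<lambda>t0. ?P t0 t1 t2)" for t1 t2
      unfolding pt0 by (rule thick_S_w[OF H in_B])
    show "thick (\<lambda>t1. ?P t0 t1 t2)" for t0 t2
      unfolding pt1 by (rule thick_S_w[OF H in_B])
    show "\<Phi> (pt t0 t1 t2) = \<Phi> (pt t0' t1 t2)" if "?P t0 t1 t2" "?P t0' t1 t2" for t0 t0' t1 t2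
      using that unfolding pt0 by (rule const_w[OF \<Phi> in_B])
    show "\<Phi> (pt t0 t1 t2) = \<Phi> (pt t0 t1' t2)" if "?P t0 t1 t2" "?P t0 t1' t2" for t0 t1 t1' t2
      using that unfolding pt1 by (rule const_w[OF \<Phi> in_B])
    show "\<Phi> (pt t0 t1 t2) = \<Phi> (pt t0 t1 t2')" if "?P t0 t1 t2" "?P t0 t1 t2'" for t0 t1 t2 t2'
      using that unfolding pt_def by (rule const_w[OF \<Phi> in_B])
  qed
  have "\<exists>t0 t1 t2. ?P t0 t1 t2 \<and> \<Phi> g = \<Phi> (pt t0 t1 t2)" if "g \<in> S H" for g
  proof -
    have "g \<in> B" using that by (simp add: S_def)
    from repr[OF this] show ?thesis using that \<Phi>(1) pt_B S_y_iff by metis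
  qed
  then show "\<Phi> g = \<Phi> h" using gh const by metis
qed

text \<open>Here \<open>z\<close> and \<open>w 1\<close> generate a Heisenberg group with centre
  \<open>r\<close>. As \<open>r\<close> also commutes with \<open>a 1\<close>, \<open>S H\<close> is
  a union of cosets of the image of \<open>r\<close>. Once \<open>\<Phi>\<close> is constant on
  these cosets, only a square with coordinates along \<open>z\<close> and \<open>w 1\<close> is
  left.\<close>

lemma connected_heisenberg:
  assumes r: "one_param r" and rB: "\<And>t. r t \<in> B"
    and ry: "\<And>s t. r s \<otimes> y t = y t \<otimes> r s" and rz: "\<And>s t. r s \<otimes> z t = z t \<otimes> r s"
    and ra: "\<And>s. r s \<otimes> a 1 = a 1 \<otimes> r s"
    and comm: "\<And>s t. z s \<otimes> w 1 t = w 1 t \<otimes> z s \<otimes> r (2 * s * t)"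
    and span: "\<And>s t. \<exists>t0 t1 t2. w s t = z t0 \<otimes> w 1 t1 \<otimes> r t2"
    and H: "subgroup H G"
  shows "connected H"
  unfolding connected_def
proof (intro allI impI ballI)
  fix \<Phi> :: "'a \<Rightarrow> bool" and g h
  assume \<Phi>: "\<forall>g\<in>B. \<forall>t. \<Phi> (g \<otimes> y t) = \<Phi> g"
    "\<forall>g\<in>S H. \<forall>t. g \<otimes> z t \<in> S H \<longrightarrow> \<Phi> (g \<otimes> z t) = \<Phi> g"
    and gh: "g \<in> S H" "h \<in> S H"
  note const_w = const_w[OF \<Phi>]
  have const_z: "\<Phi> (g \<otimes> z t) = \<Phi> (g \<otimes> z t')" if "g \<in> B" "g \<otimes> z t \<in> S H" "g \<otimes> z t' \<in> S H" for g t t'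
    using const_w[of g 0 t t'] that by simp
  have [simp]: "r t \<in> carrier G" for t using r by (rule one_param_closed)
  have S_B: "g \<in> B" if "g \<in> S H" for g using that by (simp add: S_def)
  have rw: "r s \<otimes> w s' t = w s' t \<otimes> r s" for s s' t
  proof -
    have "r s \<otimes> w s' t = (r s \<otimes> y s') \<otimes> z t \<otimes> y (- s')" by (simp add: w_def m_assoc)
    also have "\<dots> = y s' \<otimes> (r s \<otimes> z t) \<otimes> y (- s')" by (simp add: ry m_assoc)
    also have "\<dots> = y s' \<otimes> z t \<otimes> (r s \<otimes> y (- s'))" by (simp add: rz m_assoc)
    also have "\<dots> = w s' t \<otimes> r s" by (simp add: ry w_def m_assoc)
    finally show ?thesis .
  qed
  have r_lcomm: "r s \<otimes> (x \<otimes> g) = x \<otimes> (r s \<otimes> g)"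
    if "r s \<otimes> x = x \<otimes> r s" "x \<in> carrier G" "g \<in> carrier G" for s x g
    using that by (metis m_assoc \<open>\<And>t. r t \<in> carrier G\<close>)
  have r_add: "r s \<otimes> (r t \<otimes> g) = r (s + t) \<otimes> g" if "g \<in> carrier G" for s t g
    using that one_param_add[OF r, of s t] by (simp flip: m_assoc)
  note r_simps = m_assoc rz rw r_lcomm[OF rz] r_lcomm[OF rw] r_add one_param_add[OF r]
  have S_r: "g \<otimes> r t \<in> S H \<longleftrightarrow> g \<in> S H" if "g \<in> B" for g t
  proof -
    have [simp]: "g \<in> carrier G" using that by (rule B_closed)
    have "g \<otimes> r t \<otimes> a 1 \<otimes> inv (g \<otimes> r t) = g \<otimes> (r t \<otimes> a 1) \<otimes> inv (r t) \<otimes> inv g"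
      by (simp add: inv_mult_group m_assoc)
    also have "\<dots> = g \<otimes> a 1 \<otimes> inv g" by (simp add: ra m_assoc inv_solve_right)
    finally show ?thesis using that rB by (simp add: S_def B_mult')
  qed
  text \<open>Round a commutator of \<open>z\<close> and \<open>w 1\<close>, inside \<open>S H\<close>, one comes back translated along \<open>r\<close>.\<close>
  have const_r: "\<Phi> (g \<otimes> r t) = \<Phi> g" if g: "g \<in> S H" for g t
  proof -
    have gB: "g \<in> B" using g by (rule S_B)
    have [simp]: "g \<in> carrier G" using gB by (rule B_closed)
    have "g \<otimes> z 0 \<in> S H" using g by (simp add: one_param_0[OF hom_z])
    then obtain t0 where t0: "\<And>t. t \<noteq> t0 \<Longrightarrow> g \<otimes> z t \<in> S H"
      using thick_S[OF H gB] unfolding thick_def by blast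
    obtain s where s: "s \<noteq> 0" "g \<otimes> z s \<in> S H"
      using avoid_two[of 0 t0] t0 card_k by auto
    have "g \<otimes> z s \<otimes> w 1 0 \<in> S H" "g \<otimes> w 1 0 \<in> S H"
      using s g by (simp_all add: one_param_0[OF one_param_w])
    then obtain t1 t2 where t12: "\<And>t. t \<noteq> t1 \<Longrightarrow> g \<otimes> z s \<otimes> w 1 t \<in> S H" "\<And>t. t \<noteq> t2 \<Longrightarrow> g \<otimes> w 1 t \<in> S H"
      using thick_S_w[OF H S_B[OF s(2)], of 1] thick_S_w[OF H gB, of 1] unfolding thick_def by blast
    \<comment> \<open>Besides 0, \<open>t'\<close> avoids the gaps of the two lines in direction
      \<open>w 1\<close> that form opposite sides of the commutator loop.\<close>
    obtain t' where t': "t' \<noteq> 0" "g \<otimes> z s \<otimes> w 1 t' \<in> S H" "g \<otimes> w 1 t' \<in> S H"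
      using avoid_three[of 0 t1 t2] t12 card_k by auto
    let ?c = "2 * s * t'"
    have step: "\<Phi> (g \<otimes> r (v + ?c)) = \<Phi> (g \<otimes> r v)" for v
    proof -
      let ?h = "g \<otimes> r v" and ?k = "g \<otimes> r (v + ?c)"
      have h: "?h \<in> S H" "?k \<in> S H" and B: "?h \<in> B" "?k \<in> B"
        using S_r[OF gB] g gB rB by (simp_all add: B_mult')
      have comm_r: "?h \<otimes> x = g \<otimes> x \<otimes> r v" "?k \<otimes> x = g \<otimes> x \<otimes> r (v + ?c)"
        if "\<And>s. r s \<otimes> x = x \<otimes> r s" "x \<in> carrier G" for x
        using that by (simp_all add: m_assoc)
      have 1: "?h \<otimes> z s \<in> S H"
        using s(2) S_r[of "g \<otimes> z s"] gB by (simp add: comm_r rz)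
      have "?h \<otimes> z s \<otimes> w 1 t' = g \<otimes> z s \<otimes> w 1 t' \<otimes> r v"
        by (simp add: r_simps)
      then have 2: "?h \<otimes> z s \<otimes> w 1 t' \<in> S H"
        using t'(2) S_r[of "g \<otimes> z s \<otimes> w 1 t'"] gB by (simp add: B_mult')
      have 3: "?k \<otimes> w 1 t' \<in> S H"
        using t'(3) S_r[of "g \<otimes> w 1 t'"] gB by (simp add: comm_r rw B_mult')
      have "?h \<otimes> z s \<otimes> w 1 t' = g \<otimes> (r v \<otimes> (z s \<otimes> w 1 t'))" by (simp add: m_assoc)
      also have "\<dots> = ?k \<otimes> w 1 t' \<otimes> z s" unfolding comm by (simp add: r_simps add.commute)
      finally have 4: "?h \<otimes> z s \<otimes> w 1 t' = ?k \<otimes> w 1 t' \<otimes> z s" .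
      have "\<Phi> ?h = \<Phi> (?h \<otimes> z s)"
        using const_z[of ?h 0 s] B h 1 by (simp add: one_param_0[OF hom_z])
      also have "\<dots> = \<Phi> (?h \<otimes> z s \<otimes> w 1 t')"
        using const_w[of "?h \<otimes> z s" 1 0 t'] B 1 2 B_closed by (simp add: one_param_0[OF one_param_w])
      also have "\<dots> = \<Phi> (?k \<otimes> w 1 t')"
        using const_z[of "?k \<otimes> w 1 t'" s 0] B 2 3 B_closed unfolding 4 by (simp add: one_param_0[OF hom_z] B_mult')
      also have "\<dots> = \<Phi> ?k"
        using const_w[of ?k 1 t' 0] B h 3 by (simp add: one_param_0[OF one_param_w])
      finally show ?thesis by simp
    qed
    \<comment> \<open>The loop translates by \<open>?c\<close>, which is nonzero in odd
      characteristic, so its natural multiples exhaust the prime field.\<close>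
    have "\<Phi> (g \<otimes> r (of_nat n * ?c)) = \<Phi> g" for n
    proof (induction n)
      case (Suc n)
      have "of_nat (Suc n) * ?c = of_nat n * ?c + ?c" by (simp add: distrib_right add.commute)
      with Suc step show ?case by (simp only:)
    qed (simp add: one_param_0[OF r])
    moreover obtain n where "t / ?c = of_nat n" using range_of_nat_prime_field[OF prime_k] by blast
    ultimately show ?thesis using s(1) t'(1) two_neq_0[OF card_k] by (metis mult_eq_0_iff nonzero_eq_divide_eq)
  qed
  have repr: "\<exists>t0 t1 t2 s. g = z t0 \<otimes> w 1 t1 \<otimes> r t2 \<otimes> y s" if "g \<in> B" for g
    using that
  proof (induction rule: B_induct)
    case one
    have "\<one> = z 0 \<otimes> w 1 0 \<otimes> r 0 \<otimes> y 0"
      by (simp add: one_param_0[OF one_param_w] one_param_0[OF hom_y] one_param_0[OF hom_z] one_param_0[OF r])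
    then show ?case by blast
  next
    case (y g t)
    then obtain t0 t1 t2 s where "g = z t0 \<otimes> w 1 t1 \<otimes> r t2 \<otimes> y s" by blast
    then have "g \<otimes> y t = z t0 \<otimes> w 1 t1 \<otimes> r t2 \<otimes> y (s + t)"
      by (simp add: m_assoc one_param_add[OF hom_y])
    then show ?case by blast
  next
    case (z g t)
    then obtain t0 t1 t2 s where g: "g = z t0 \<otimes> w 1 t1 \<otimes> r t2 \<otimes> y s" by blast
    obtain u0 u1 u2 where u: "w s t = z u0 \<otimes> w 1 u1 \<otimes> r u2" using span by blast
    have wz: "w 1 t1 \<otimes> z u0 = z u0 \<otimes> w 1 t1 \<otimes> r (- (2 * u0 * t1))"
      unfolding comm using one_param_add[OF r, of "2 * u0 * t1" "- (2 * u0 * t1)"]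
      by (simp add: m_assoc one_param_0[OF r])
    have "g \<otimes> z t = z t0 \<otimes> w 1 t1 \<otimes> (r t2 \<otimes> w s t) \<otimes> y s" by (simp add: g m_assoc y_z)
    also have "\<dots> = z t0 \<otimes> (w 1 t1 \<otimes> z u0) \<otimes> w 1 u1 \<otimes> r (t2 + u2) \<otimes> y s"
      unfolding u by (simp add: r_simps)
    also have "\<dots> = (z t0 \<otimes> z u0) \<otimes> (w 1 t1 \<otimes> w 1 u1) \<otimes> r (- (2 * u0 * t1) + (t2 + u2)) \<otimes> y s"
      unfolding wz by (simp add: r_simps)
    finally show ?case
      unfolding one_param_add[OF r] one_param_add[OF hom_z] one_param_add[OF one_param_w] by blast
  qed
  let ?P = "\<lambda>t0 t1. z t0 \<otimes> w 1 t1 \<in> S H"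
  have ptB: "z t0 \<otimes> w 1 t1 \<in> B" "w 1 t1 \<otimes> z t0 \<in> B" for t0 t1
    by (simp_all add: B_mult' z_in_B)
  \<comment> \<open>Exchanging the two factors costs an element of the image of \<open>r\<close>, to
    which both \<open>S H\<close> and \<open>\<Phi>\<close> are insensitive. Lines in direction
    \<open>z\<close> can thus be treated with \<open>z\<close> as the last factor.\<close>
  have P_iff: "?P t0 t1 \<longleftrightarrow> w 1 t1 \<otimes> z t0 \<in> S H" for t0 t1
    using S_r[OF ptB(2)] by (simp add: comm)
  have const_swap: "\<Phi> (z t0 \<otimes> w 1 t1) = \<Phi> (w 1 t1 \<otimes> z t0)" if "?P t0 t1" for t0 t1
    using const_r that P_iff by (simp add: comm)
  have const: "\<Phi> (z t0 \<otimes> w 1 t1) = \<Phi> (z u0 \<otimes> w 1 u1)" if "?P t0 t1" "?P u0 u1" for t0 t1 u0 u1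
  proof (rule square_connected[where P = ?P and f = "\<lambda>t0 t1. \<Phi> (z t0 \<otimes> w 1 t1)", OF _ _ _ _ that])
    show "CARD('k) > 2" by (simp add: card_k)
    show "thick (\<lambda>t0. ?P t0 t1)" for t1
      unfolding P_iff by (rule thick_S[OF H]) simp
    show "\<Phi> (z t0 \<otimes> w 1 t1) = \<Phi> (z t0' \<otimes> w 1 t1)" if "?P t0 t1" "?P t0' t1" for t0 t0' t1
      using that const_swap const_z[of "w 1 t1" t0 t0'] P_iff by simp
    show "\<Phi> (z t0 \<otimes> w 1 t1) = \<Phi> (z t0 \<otimes> w 1 t1')" if "?P t0 t1" "?P t0 t1'" for t0 t1 t1'
      by (rule const_w[OF z_in_B that])
  qed
  have "\<exists>t0 t1. ?P t0 t1 \<and> \<Phi> g = \<Phi> (z t0 \<otimes> w 1 t1)" if gS: "g \<in> S H" for g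
  proof -
    obtain t0 t1 t2 s where g: "g = z t0 \<otimes> w 1 t1 \<otimes> r t2 \<otimes> y s" using repr S_B[OF gS] by blast
    have B: "z t0 \<otimes> w 1 t1 \<otimes> r t2 \<in> B" using ptB rB by (simp add: B_mult')
    then have "z t0 \<otimes> w 1 t1 \<otimes> r t2 \<in> S H" "\<Phi> g = \<Phi> (z t0 \<otimes> w 1 t1 \<otimes> r t2)"
      using gS \<Phi>(1) unfolding g by (simp_all only: S_y_iff)
    then show ?thesis using const_r S_r[OF ptB(1)] by metis
  qed
  then show "\<Phi> g = \<Phi> h" using gh const by metis
qed

end

section \<open>Coset complexes with three types of vertices\<close>

locale coset_triangle = group G for G (structure) +
  fixes K :: "'i \<Rightarrow> 'a set" and i j k :: 'i
  assumes distinct: "i \<noteq> j" "i \<noteq> k" "j \<noteq> k"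
    and subgroups: "subgroup (K i) G" "subgroup (K j) G" "subgroup (K k) G"
begin

definition X where "X = coset_complex G {i, j, k} K"

definition v :: "'i \<Rightarrow> 'a \<Rightarrow> 'i \<times> 'a set" where "v l g = (l, g <# K l)"

lemma subgroup_K: "l \<in> {i, j, k} \<Longrightarrow> subgroup (K l) G"
  using subgroups by auto

lemma v_mult:
  assumes "l \<in> {i, j, k}" "g \<in> carrier G" "x \<in> K l" shows "v l (g \<otimes> x) = v l g"
proof -
  note K = subgroup_K[OF assms(1)]
  have "x \<in> carrier G" using subgroup.mem_carrier[OF K assms(3)] .
  then have "g \<otimes> x <# K l = g <# (x <# K l)"
    using assms(2) subgroup.subset[OF K] by (simp add: lcos_m_assoc)
  also have "x <# K l = K l" using K assms(3) by (simp add: coset_join3 subgroup.mem_carrier)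
  finally show ?thesis by (simp add: v_def)
qed

lemma v_eqD:
  assumes "l \<in> {i, j, k}" "g \<in> carrier G" "h \<in> carrier G" "v l g = v l h"
  shows "\<exists>x\<in>K l. g = h \<otimes> x"
proof -
  have "\<one> \<in> K l" using subgroup_K[OF assms(1)] by (rule subgroup.one_closed)
  then have "g \<in> g <# K l" using assms(2) by (force simp: l_coset_def)
  then show ?thesis using assms(4) by (auto simp: v_def l_coset_def)
qed

lemma X_eq: "X = {\<sigma>. \<sigma> \<noteq> {} \<and> (\<exists>g\<in>carrier G. \<sigma> \<subseteq> {v i g, v j g, v k g})}"
proof -
  have "{(l, g <# K l) |l. l \<in> {i, j, k}} = {v i g, v j g, v k g}" for g
    by (auto simp: v_def)
  then show ?thesis by (simp add: X_def coset_complex_def)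
qed

lemma v_neq [simp]: "v i g \<noteq> v j h" "v i g \<noteq> v k h" "v j g \<noteq> v k h"
  "v j g \<noteq> v i h" "v k g \<noteq> v i h" "v k g \<noteq> v j h"
  using distinct by (auto simp: v_def)

lemma faces_0: "faces X 0 = {{v l g} | l g. l \<in> {i, j, k} \<and> g \<in> carrier G}"
  unfolding faces_def X_eq by (auto simp: card_Suc_eq)

lemma faces_2: "faces X 2 = {{v i g, v j g, v k g} | g. g \<in> carrier G}"
proof -
  have card: "card {v i g, v j g, v k g} = 3" for g by simp
  have "\<sigma> = {v i g, v j g, v k g}" if "\<sigma> \<subseteq> {v i g, v j g, v k g}" "card \<sigma> = 3" for \<sigma> g
    using that card by (metis card_subset_eq finite.emptyI finite.insertI)
  then show ?thesis
    unfolding faces_def X_eq by (auto simp: card eval_nat_numeral)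
qed

lemma edge_cases:
  assumes "\<sigma> \<subseteq> {v i g, v j g, v k g}" "card \<sigma> = 2"
  shows "\<sigma> \<in> {{v i g, v j g}, {v i g, v k g}, {v j g, v k g}}"
proof -
  obtain p q where \<sigma>: "\<sigma> = {p, q}" "p \<noteq> q" using assms(2) by (meson card_2_iff)
  have "p \<in> {v i g, v j g, v k g}" "q \<in> {v i g, v j g, v k g}" using assms(1) \<sigma> by auto
  then show ?thesis
    using \<sigma> by (elim insertE emptyE) (simp_all add: insert_commute)
qed

lemma faces_1: "faces X 1 = (\<Union>g\<in>carrier G. {{v i g, v j g}, {v i g, v k g}, {v j g, v k g}})"
proof (intro equalityI subsetI)
  fix \<sigma> assume "\<sigma> \<in> faces X 1"
  then obtain g where g: "g \<in> carrier G" and "\<sigma> \<subseteq> {v i g, v j g, v k g}" "card \<sigma> = 2"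
    unfolding faces_def X_eq by auto
  then show "\<sigma> \<in> (\<Union>g\<in>carrier G. {{v i g, v j g}, {v i g, v k g}, {v j g, v k g}})"
    using edge_cases by blast
next
  fix \<sigma> assume "\<sigma> \<in> (\<Union>g\<in>carrier G. {{v i g, v j g}, {v i g, v k g}, {v j g, v k g}})"
  then obtain g where g: "g \<in> carrier G"
    and \<sigma>: "\<sigma> = {v i g, v j g} \<or> \<sigma> = {v i g, v k g} \<or> \<sigma> = {v j g, v k g}" by blast
  then have "\<sigma> \<in> X" unfolding X_eq by blast
  moreover have "card \<sigma> = 2" "finite \<sigma>" using \<sigma> by auto
  ultimately show "\<sigma> \<in> faces X 1" by (simp add: faces_def)
qed

lemma edges:
  assumes "g \<in> carrier G"
  shows "{v i g, v j g} \<in> faces X 1" "{v i g, v k g} \<in> faces X 1" "{v j g, v k g} \<in> faces X 1"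
  unfolding faces_1 using assms by blast+

lemma coboundary_1:
  assumes g: "g \<in> carrier G"
  shows "coboundary X 1 f {v i g, v j g, v k g} = f {v i g, v j g} + f {v i g, v k g} + f {v j g, v k g}"
proof -
  let ?T = "{v i g, v j g, v k g}"
  have "\<sigma> \<in> {{v i g, v j g}, {v i g, v k g}, {v j g, v k g}}" if "\<sigma> \<in> faces X 1" "\<sigma> \<subseteq> ?T" for \<sigma>
    using that edge_cases by (simp add: faces_def numeral_2_eq_2)
  then have "{\<sigma> \<in> faces X 1. \<sigma> \<subseteq> ?T} = {{v i g, v j g}, {v i g, v k g}, {v j g, v k g}}"
    using edges[OF g] by blast
  moreover have "?T \<in> faces X (Suc 1)"
    using g faces_2 unfolding Suc_1 by blast
  \<comment> \<open>The three edges are distinct, so the sum over the set of edges has three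
    terms.\<close>
  moreover have "{v i g, v j g} \<notin> {{v i g, v k g}, {v j g, v k g}}" "{v i g, v k g} \<notin> {{v j g, v k g}}"
    by (auto simp: doubleton_eq_iff)
  ultimately show ?thesis
    unfolding coboundary_def by (simp only: if_True) (simp add: add.assoc)
qed

lemma coboundary_0:
  assumes "{p, q} \<in> faces X 1" "p \<noteq> q"
  shows "coboundary X 0 f {p, q} = f {p} + f {q}"
proof -
  have "{p} \<in> faces X 0" "{q} \<in> faces X 0"
    using assms(1) unfolding faces_def X_eq by auto
  then have "{\<sigma> \<in> faces X 0. \<sigma> \<subseteq> {p, q}} = {{p}, {q}}"
    by (auto simp: faces_def card_Suc_eq)
  then show ?thesis using assms by (simp add: coboundary_def)
qed

lemma coboundary_0_edges:
  assumes "g \<in> carrier G"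
  shows "coboundary X 0 f {v i g, v j g} = f {v i g} + f {v j g}"
    "coboundary X 0 f {v i g, v k g} = f {v i g} + f {v k g}"
    "coboundary X 0 f {v j g, v k g} = f {v j g} + f {v k g}"
  by (rule coboundary_0; use edges[OF assms] in simp)+

text \<open>The edge of a given type in the triangle of \<open>g\<close> depends on \<open>g\<close>
  only modulo the intersection of two of the subgroups. Pulling cochains back to the group thus
  leaves a splitting problem for invariant functions.\<close>

lemma vanishing_1_cohomology_X:
  assumes split: "\<And>fij fik fjk :: 'a \<Rightarrow> bit.
      (\<And>g x. g \<in> carrier G \<Longrightarrow> x \<in> K i \<inter> K j \<Longrightarrow> fij (g \<otimes> x) = fij g) \<Longrightarrow>
      (\<And>g x. g \<in> carrier G \<Longrightarrow> x \<in> K i \<inter> K k \<Longrightarrow> fik (g \<otimes> x) = fik g) \<Longrightarrow>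
      (\<And>g x. g \<in> carrier G \<Longrightarrow> x \<in> K j \<inter> K k \<Longrightarrow> fjk (g \<otimes> x) = fjk g) \<Longrightarrow>
      (\<And>g. g \<in> carrier G \<Longrightarrow> fij g + fik g + fjk g = 0) \<Longrightarrow>
      \<exists>u. (\<forall>l\<in>{i, j, k}. \<forall>g\<in>carrier G. \<forall>x\<in>K l. u l (g \<otimes> x) = u l g) \<and>
        (\<forall>g\<in>carrier G. fij g = u i g + u j g \<and> fik g = u i g + u k g \<and> fjk g = u j g + u k g)"
  shows "vanishing_1_cohomology X"
  unfolding vanishing_1_cohomology_def
proof (intro equalityI subsetI)
  fix f assume "f \<in> coboundary X 0 ` cochains X 0"
  then obtain u where f: "f = coboundary X 0 u" by blast
  have "coboundary X 1 f \<tau> = 0" for \<tau>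
  proof (cases "\<tau> \<in> faces X 2")
    case True
    then obtain g where "g \<in> carrier G" "\<tau> = {v i g, v j g, v k g}" unfolding faces_2 by blast
    then show ?thesis unfolding f by (simp only: coboundary_1 coboundary_0_edges) (simp add: ac_simps)
  qed (simp add: coboundary_def numeral_2_eq_2)
  moreover have "f \<in> cochains X 1" by (simp add: f cochains_def coboundary_def)
  ultimately show "f \<in> {f \<in> cochains X 1. coboundary X 1 f = (\<lambda>_. 0)}" by auto
next
  fix f assume "f \<in> {f \<in> cochains X 1. coboundary X 1 f = (\<lambda>_. 0)}"
  then have f: "f \<in> cochains X 1" and df: "coboundary X 1 f = (\<lambda>_. 0)" by auto
  have inv: "v l (g \<otimes> x) = v l g" if "g \<in> carrier G" "x \<in> K l" "l \<in> {i, j, k}" for l g x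
    using that v_mult by blast
  have "\<exists>u. (\<forall>l\<in>{i, j, k}. \<forall>g\<in>carrier G. \<forall>x\<in>K l. u l (g \<otimes> x) = u l g) \<and>
      (\<forall>g\<in>carrier G. f {v i g, v j g} = u i g + u j g \<and> f {v i g, v k g} = u i g + u k g \<and>
        f {v j g, v k g} = u j g + u k g)"
  proof (rule split)
    show "f {v i g, v j g} + f {v i g, v k g} + f {v j g, v k g} = 0" if "g \<in> carrier G" for g
      using coboundary_1[OF that, of f] df by (simp only:)
  qed (simp_all add: inv)
  then obtain u where u: "\<forall>l\<in>{i, j, k}. \<forall>g\<in>carrier G. \<forall>x\<in>K l. u l (g \<otimes> x) = u l g"
    and fu: "\<forall>g\<in>carrier G. f {v i g, v j g} = u i g + u j g \<and> f {v i g, v k g} = u i g + u k g \<and>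
      f {v j g, v k g} = u j g + u k g"
    by blast
  \<comment> \<open>\<open>u\<close> descends to vertices: a representative of the coset is chosen,
    and invariance makes its choice irrelevant. The value 0 elsewhere is what
    \<open>cochains\<close> demands.\<close>
  define w where "w \<sigma> = (if \<sigma> \<in> faces X 0 then
      let p = the_elem \<sigma> in u (fst p) (SOME g. g \<in> carrier G \<and> p = v (fst p) g) else 0)" for \<sigma>
  have w: "w {v l g} = u l g" if l: "l \<in> {i, j, k}" and g: "g \<in> carrier G" for l g
  proof -
    define h where "h = (SOME h. h \<in> carrier G \<and> v l g = v l h)"
    have h: "h \<in> carrier G \<and> v l g = v l h"
      unfolding h_def by (rule someI[of _ g]) (use g in simp)
    then obtain x where "x \<in> K l" "g = h \<otimes> x" using v_eqD[OF l g] by blast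
    then have "u l h = u l g" using u l h by metis
    moreover have "fst (v l g) = l" by (simp add: v_def)
    moreover have "{v l g} \<in> faces X 0" using l g unfolding faces_0 by blast
    ultimately show ?thesis by (simp add: w_def h_def)
  qed
  have "w \<in> cochains X 0" by (simp add: w_def cochains_def)
  moreover have "f \<sigma> = coboundary X 0 w \<sigma>" for \<sigma>
  proof (cases "\<sigma> \<in> faces X 1")
    case True
    then obtain g where g: "g \<in> carrier G"
      and "\<sigma> = {v i g, v j g} \<or> \<sigma> = {v i g, v k g} \<or> \<sigma> = {v j g, v k g}"
      unfolding faces_1 by blast
    then show ?thesis by (elim disjE) (simp_all add: coboundary_0_edges fu[rule_format] w)
  next
    case False
    then show ?thesis using f by (simp add: cochains_def coboundary_def)
  qed
  ultimately show "f \<in> coboundary X 0 ` cochains X 0" by blast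
qed

end

section \<open>From split cocycles to vanishing cohomology\<close>

lemma (in group) right_invariant_generate:
  assumes S: "S \<subseteq> carrier G" and inv: "\<And>s. s \<in> S \<Longrightarrow> inv s \<in> S"
    and u: "\<And>g s. g \<in> carrier G \<Longrightarrow> s \<in> S \<Longrightarrow> u (g \<otimes> s) = u g"
    and "g \<in> carrier G" "x \<in> generate G S"
  shows "u (g \<otimes> x) = u g"
proof -
  have "\<forall>g\<in>carrier G. u (g \<otimes> x) = u g"
    using assms(5)
  proof (induction rule: generate_right_induct)
    case (right x s)
    then show ?case using S u by (auto simp flip: m_assoc)
  qed (use S inv in auto)
  then show ?thesis using assms(4) by blast
qed

text \<open>The vertex types \<open>i\<close>, \<open>j\<close>, \<open>k\<close> omit the
  generators \<open>a\<close>, \<open>z\<close>, \<open>y\<close> in this order. The edge functions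
  \<open>fij\<close> and \<open>fik\<close> take the roles of \<open>fc\<close> and
  \<open>fb\<close>.\<close>

lemma (in amalgam) vanishing_coset_complex:
  assumes conn: "\<And>H. subgroup H G \<Longrightarrow> H \<subseteq> Q \<Longrightarrow> connected H"
    and distinct: "i \<noteq> j" "i \<noteq> k" "j \<noteq> k"
    and K: "K i = generate G (range y \<union> range z)" "K j = generate G (range a \<union> range y)"
      "K k = generate G (range a \<union> range z)"
  shows "vanishing_1_cohomology (coset_complex G {i, j, k} K)"
proof -
  interpret coset_triangle G K i j k
  proof (intro coset_triangle.intro coset_triangle_axioms.intro is_group)
    show "subgroup (K i) G" "subgroup (K j) G" "subgroup (K k) G"
      unfolding K by (rule generate_is_subgroup; auto)+
  qed (fact distinct)+
  have "vanishing_1_cohomology X"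
  proof (rule vanishing_1_cohomology_X)
    fix fij fik fjk :: "'a \<Rightarrow> bit"
    assume ij: "\<And>g x. g \<in> carrier G \<Longrightarrow> x \<in> K i \<inter> K j \<Longrightarrow> fij (g \<otimes> x) = fij g"
      and ik: "\<And>g x. g \<in> carrier G \<Longrightarrow> x \<in> K i \<inter> K k \<Longrightarrow> fik (g \<otimes> x) = fik g"
      and jk: "\<And>g x. g \<in> carrier G \<Longrightarrow> x \<in> K j \<inter> K k \<Longrightarrow> fjk (g \<otimes> x) = fjk g"
      and sum: "\<And>g. g \<in> carrier G \<Longrightarrow> fij g + fik g + fjk g = 0"
    have jk_sum: "fik g + fij g = fjk g" if "g \<in> carrier G" for g
      using sum[OF that] by (metis add.commute add.right_neutral bit_add_self_left add.assoc)
    have "y t \<in> K i \<inter> K j" "z t \<in> K i \<inter> K k" "a t \<in> K j \<inter> K k" for t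
      unfolding K by (auto intro: generate.incl)
    then have inv: "fij (g \<otimes> y t) = fij g" "fik (g \<otimes> z t) = fik g" "fjk (g \<otimes> a t) = fjk g"
      if "g \<in> carrier G" for g t
      using that ij ik jk by blast+
    then have "cocycle fik fij" by (simp add: cocycle_def jk_sum)
    then have "split fij" using conn by (rule cocycle_split[rotated])
    then obtain u where u: "\<And>g t. g \<in> carrier G \<Longrightarrow> u (g \<otimes> y t) = u g"
      "\<And>g t. g \<in> carrier G \<Longrightarrow> u (g \<otimes> z t) = u g"
      "\<And>g t. g \<in> carrier G \<Longrightarrow> fij (g \<otimes> a t) + u (g \<otimes> a t) = fij g + u g"
      unfolding split_def by blast
    have ik_eq: "fik g = fjk g + fij g" if "g \<in> carrier G" for g
      by (simp flip: jk_sum[OF that] add: add.assoc)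
    have uk: "fik (g \<otimes> a t) + u (g \<otimes> a t) = fik g + u g" if "g \<in> carrier G" for g t
      using that by (simp add: ik_eq add.assoc inv u)
    \<comment> \<open>The values at \<open>j\<close> and \<open>k\<close> are forced by
      \<open>u\<close> at \<open>i\<close> and the edges \<open>ij\<close> and \<open>ik\<close>;
      the edge \<open>jk\<close> then fits by the cocycle condition.\<close>
    define u' where "u' l g = (if l = i then u g else if l = j then fij g + u g else fik g + u g)" for l g
    have generators: "s \<in> S \<Longrightarrow> inv s \<in> S" if "S \<in> {range y \<union> range z, range a \<union> range y, range a \<union> range z}" for s S
      using that by (auto simp: one_param_inv hom_a hom_y hom_z)
    have "u' l (g \<otimes> x) = u' l g" if l: "l \<in> {i, j, k}" and g: "g \<in> carrier G" and x: "x \<in> K l" for l g x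
      using l
    proof (elim insertE emptyE)
      assume l: "l = i"
      then have x': "x \<in> generate G (range y \<union> range z)" using x K by simp
      show ?thesis unfolding l
        by (rule right_invariant_generate[OF _ generators _ g x']) (auto simp: u'_def u)
    next
      assume l: "l = j"
      then have x': "x \<in> generate G (range a \<union> range y)" using x K by simp
      show ?thesis unfolding l
        by (rule right_invariant_generate[OF _ generators _ g x']) (use distinct in \<open>auto simp: u'_def u inv\<close>)
    next
      assume l: "l = k"
      then have x': "x \<in> generate G (range a \<union> range z)" using x K by simp
      show ?thesis unfolding l
        by (rule right_invariant_generate[OF _ generators _ g x']) (use distinct in \<open>auto simp: u'_def u uk inv\<close>)
    qed
    moreover have "fij g = u' i g + u' j g \<and> fik g = u' i g + u' k g \<and> fjk g = u' j g + u' k g"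
      if "g \<in> carrier G" for g
      using distinct by (simp add: u'_def ac_simps flip: jk_sum[OF that])
    ultimately show "\<exists>u. (\<forall>l\<in>{i, j, k}. \<forall>g\<in>carrier G. \<forall>x\<in>K l. u l (g \<otimes> x) = u l g) \<and>
        (\<forall>g\<in>carrier G. fij g = u i g + u j g \<and> fik g = u i g + u k g \<and> fjk g = u j g + u k g)"
      by (intro exI[of _ u']) blast
  qed
  then show ?thesis by (simp add: X_def)
qed

section \<open>Root elements as block matrices\<close>

definition scale :: "'k::comm_ring_1 \<Rightarrow> 'k ^ 'n ^ 'n \<Rightarrow> 'k ^ 'n ^ 'n" where
  "scale t M = (\<chi> b' b. t * M $ b' $ b)"

lemma scale_nth [simp]: "scale t M $ b' $ b = t * M $ b' $ b"
  by (simp add: scale_def)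

lemma matrix_add_rdistrib: "(A + B) ** C = A ** C + B ** (C :: 'k::comm_ring_1 ^ 'n ^ 'n)"
  by (simp add: matrix_matrix_mult_def vec_eq_iff sum.distrib algebra_simps)

lemma scale_mult_left: "scale t M ** N = scale t (M ** N)"
  by (simp add: matrix_matrix_mult_def vec_eq_iff sum_distrib_left mult.assoc)

lemma scale_mult_right: "M ** scale t N = scale t (M ** N)"
  by (simp add: matrix_matrix_mult_def vec_eq_iff sum_distrib_left mult.left_commute)

lemma scale_add_right: "scale t (M + N) = scale t M + scale t N"
  by (simp add: vec_eq_iff distrib_left)

lemma scale_scale: "scale s (scale t M) = scale (s * t) M"
  by (simp add: vec_eq_iff mult.assoc)

lemma scale_zero_right [simp]: "scale t 0 = 0"
  by (simp add: vec_eq_iff)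

lemma matrix_mult_zero [simp]: "M ** 0 = (0 :: 'k::comm_ring_1 ^ 'n ^ 'n)" "0 ** M = (0 :: 'k ^ 'n ^ 'n)"
  by (simp_all add: matrix_matrix_mult_def vec_eq_iff)

text \<open>These rules expand products of unipotent matrices into sums of scaled words, nested to
  the right.\<close>

lemmas expand_simps = matrix_add_ldistrib matrix_add_rdistrib scale_mult_left scale_mult_right
  scale_add_right scale_scale matrix_mul_assoc[symmetric] matrix_mul_lid matrix_mul_rid
  scale_zero_right matrix_mult_zero add_0_left add_0_right

text \<open>\<open>P\<close> divides the basis into two levels. Such a matrix is strictly block
  triangular: it kills the upper level and sends the lower level into the upper one. The matrices of
  \<open>preserves\<close> are block diagonal.\<close>

definition raises :: "('n::finite \<Rightarrow> bool) \<Rightarrow> 'k::comm_ring_1 ^ 'n ^ 'n \<Rightarrow> bool" where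
  "raises P M \<longleftrightarrow> (\<forall>b' b. M $ b' $ b \<noteq> 0 \<longrightarrow> P b' \<and> \<not> P b)"

definition preserves :: "('n::finite \<Rightarrow> bool) \<Rightarrow> 'k::comm_ring_1 ^ 'n ^ 'n \<Rightarrow> bool" where
  "preserves P M \<longleftrightarrow> (\<forall>b' b. M $ b' $ b \<noteq> 0 \<longrightarrow> P b' = P b)"

lemma matrix_mult_nonzero:
  assumes "(M ** N) $ b' $ b \<noteq> (0 :: 'k::comm_ring_1)"
  obtains c where "M $ b' $ c \<noteq> 0" "N $ c $ b \<noteq> 0"
proof -
  have "(\<Sum>c\<in>UNIV. M $ b' $ c * N $ c $ b) \<noteq> 0"
    using assms by (simp add: matrix_matrix_mult_def)
  then obtain c where "M $ b' $ c * N $ c $ b \<noteq> 0" by (meson sum.neutral)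
  then have "M $ b' $ c \<noteq> 0" "N $ c $ b \<noteq> 0" by auto
  then show ?thesis by (rule that)
qed

text \<open>With only two levels, nothing can be raised twice.\<close>

lemma raises_mult_raises: "raises P M \<Longrightarrow> raises P N \<Longrightarrow> M ** N = 0"
  unfolding vec_eq_iff by (metis matrix_mult_nonzero raises_def zero_index)

lemma raises_mult_preserves: "raises P M \<Longrightarrow> preserves P N \<Longrightarrow> raises P (M ** N)"
  unfolding raises_def preserves_def by (metis matrix_mult_nonzero)

lemma preserves_mult_raises: "preserves P M \<Longrightarrow> raises P N \<Longrightarrow> raises P (M ** N)"
  unfolding raises_def preserves_def by (metis matrix_mult_nonzero)

lemma raises_add: "raises P M \<Longrightarrow> raises P N \<Longrightarrow> raises P (M + N)"
  unfolding raises_def by (metis add_0 vector_add_component)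

lemma raises_scale: "raises P M \<Longrightarrow> raises P (scale t M)"
  unfolding raises_def by (metis mult_zero_right scale_nth)

lemma preserves_scale: "preserves P M \<Longrightarrow> preserves P (scale t M)"
  unfolding preserves_def by (metis mult_zero_right scale_nth)

lemma preserves_add: "preserves P M \<Longrightarrow> preserves P N \<Longrightarrow> preserves P (M + N)"
  unfolding preserves_def by (metis add_0 vector_add_component)

lemma preserves_one: "preserves P (mat 1)"
  by (simp add: preserves_def mat_def)

text \<open>The mixed product vanishes. This makes the kernel of \<open>diag_part\<close>
  commutative and, in characteristic 5, of exponent 5.\<close>

lemma unipotent_mult:
  "raises P M \<Longrightarrow> raises P N \<Longrightarrow> (mat 1 + M) ** (mat 1 + N) = mat 1 + (M + N)"
  by (simp add: expand_simps raises_mult_raises add_ac)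

text \<open>In the applications \<open>C\<close> squares to zero, so this is the conjugate of
  \<open>mat 1 + scale t M\<close> and the term with \<open>C ** C\<close> disappears.\<close>

lemma conj_expand:
  fixes M C :: "'k::comm_ring_1 ^ 'n ^ 'n"
  shows "(mat 1 + scale s C) ** (mat 1 + scale t M) ** (mat 1 + scale (- s) C) =
    mat 1 + scale (- (s * s)) (C ** C) +
    scale t (M + scale s (C ** M + scale (- 1) (M ** C)) + scale (- (s * s)) (C ** (M ** C)))"
  by (simp only: expand_simps) (simp add: vec_eq_iff algebra_simps)

text \<open>The projection to the block diagonal, which serves as \<open>D\<close> in the locale
  \<open>amalgam\<close>.\<close>

definition diag_part :: "('n::finite \<Rightarrow> bool) \<Rightarrow> 'k::comm_ring_1 ^ 'n ^ 'n \<Rightarrow> 'k ^ 'n ^ 'n" where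
  "diag_part P M = (\<chi> b' b. if P b' = P b then M $ b' $ b else 0)"

definition triangular :: "('n::finite \<Rightarrow> bool) \<Rightarrow> 'k::comm_ring_1 ^ 'n ^ 'n \<Rightarrow> bool" where
  "triangular P M \<longleftrightarrow> (\<forall>b' b. M $ b' $ b \<noteq> 0 \<longrightarrow> P b \<longrightarrow> P b')"

lemma triangular_mult: "triangular P M \<Longrightarrow> triangular P N \<Longrightarrow> triangular P (M ** N)"
  unfolding triangular_def by (metis matrix_mult_nonzero)

lemma triangularI: "raises P M \<Longrightarrow> triangular P (mat 1 + M)" "preserves P N \<Longrightarrow> triangular P N"
  unfolding raises_def preserves_def triangular_def mat_def by auto

text \<open>A path between two indices of the same level through the other level would have to
  descend once, which triangularity forbids.\<close>

lemma diag_part_mult: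
  assumes "triangular P M" "triangular P N"
  shows "diag_part P (M ** N) = diag_part P M ** (diag_part P N :: 'k::comm_ring_1 ^ 'n ^ 'n)"
proof -
  have "(if P b' = P b then (M ** N) $ b' $ b else 0) = (diag_part P M ** diag_part P N) $ b' $ b" for b' b
  proof (cases "P b' = P b")
    case True
    have "M $ b' $ c * N $ c $ b = 0" if "P c \<noteq> P b" for c
      using assms True that unfolding triangular_def by (metis mult_not_zero)
    then have "M $ b' $ c * N $ c $ b = diag_part P M $ b' $ c * diag_part P N $ c $ b" for c
      using True by (simp add: diag_part_def)
    then show ?thesis using True by (simp add: matrix_matrix_mult_def)
  next
    case False
    then have "diag_part P M $ b' $ c * diag_part P N $ c $ b = 0" for c
      by (simp add: diag_part_def)
    then show ?thesis using False by (simp add: matrix_matrix_mult_def)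
  qed
  then show ?thesis by (simp add: vec_eq_iff) (simp add: diag_part_def)
qed

lemma diag_part_preserves: "preserves P M \<Longrightarrow> diag_part P M = M"
  by (auto simp: vec_eq_iff diag_part_def preserves_def)

lemma diag_part_raises: "raises P M \<Longrightarrow> diag_part P (mat 1 + M) = mat 1"
  by (auto simp: vec_eq_iff diag_part_def raises_def mat_def)

lemma diag_part_eq_1:
  fixes M :: "'k::comm_ring_1 ^ 'n ^ 'n"
  assumes "triangular P M" "diag_part P M = mat 1"
  obtains N where "raises P N" "M = mat 1 + N"
proof
  have M: "(if P b' = P b then M $ b' $ b else 0) = mat 1 $ b' $ b" for b' b
    using arg_cong[OF assms(2), of "\<lambda>A. A $ b' $ b"] by (simp add: diag_part_def)
  show "raises P (M - mat 1)"
    unfolding raises_def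
  proof (intro allI impI)
    fix b' b assume nz: "(M - mat 1) $ b' $ b \<noteq> 0"
    then have "M $ b' $ b \<noteq> mat 1 $ b' $ b" by simp
    then have neq: "P b' \<noteq> P b" using M[of b' b] by metis
    then have "mat 1 $ b' $ b = (0 :: 'k)" by (auto simp: mat_def)
    then have "M $ b' $ b \<noteq> 0" using nz by simp
    then show "P b' \<and> \<not> P b" using assms(1) neq unfolding triangular_def by blast
  qed
  show "M = mat 1 + (M - mat 1)" by simp
qed

section \<open>Root elements and the groups \<open>U I\<close>\<close>

lemma root_elt_eq: "root_elt \<zeta> t = mat 1 + scale t (root_vec \<zeta>)"
  by (simp add: root_elt_def scale_def)

lemma group_GL_spin: "group (GL_spin :: ('k::field ^ spin ^ spin) monoid)"
proof (rule groupI)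
  fix x :: "'k ^ spin ^ spin" assume "x \<in> carrier GL_spin"
  then obtain y where "x ** y = mat 1" "y ** x = mat 1" by (auto simp: GL_spin_def invertible_def)
  then show "\<exists>y\<in>carrier GL_spin. y \<otimes>\<^bsub>GL_spin\<^esub> x = \<one>\<^bsub>GL_spin\<^esub>"
    by (auto simp: GL_spin_def invertible_def)
qed (auto simp: GL_spin_def invertible_mult matrix_mul_assoc invertible_def[of "mat 1"])

lemma group_B3_group: "group (B3_group :: ('k::field ^ spin ^ spin) monoid)"
  unfolding B3_group_def
  by (rule subgroup.subgroup_is_group[OF group.generate_is_subgroup[OF group_GL_spin] group_GL_spin])
    (auto simp: root_elt_in_GL)

lemma root_elt_in_B3_group: "\<zeta> \<in> B3 \<Longrightarrow> root_elt \<zeta> t \<in> carrier B3_group"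
  unfolding B3_group_def by (simp del: split_paired_Ex) (blast intro: generate.incl)

lemma U_subgroup: "I \<subseteq> B3 \<Longrightarrow> subgroup (U I) B3_group"
  unfolding U_def by (rule group.generate_is_subgroup[OF group_B3_group]) (auto intro: root_elt_in_B3_group)

abbreviation U_group :: "vec3 set \<Rightarrow> ('k::field ^ spin ^ spin) monoid" where
  "U_group I \<equiv> B3_group\<lparr>carrier := U I\<rparr>"

lemma group_U_group: "I \<subseteq> B3 \<Longrightarrow> group (U_group I)"
  by (rule subgroup.subgroup_is_group[OF U_subgroup group_B3_group])

lemma U_group_simps [simp]:
  "monoid.mult (U_group I) = (**)" "monoid.one (U_group I) = mat 1" "carrier (U_group I) = U I"
  by (simp_all add: B3_group_def GL_spin_def)

lemma root_elt_in_U: "\<zeta> \<in> I \<Longrightarrow> root_elt \<zeta> t \<in> U I"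
  unfolding U_def by (blast intro: generate.incl)

text \<open>Generating inside \<open>B3_group\<close> or inside its subgroup \<open>U I\<close>
  gives the same set; the latter is the ambient group of the coset complex.\<close>

lemma U_subset_generate:
  assumes "I \<subseteq> B3" "J \<subseteq> I"
  shows "(U J :: ('k::field ^ spin ^ spin) set) = generate (U_group I) (\<Union>\<zeta>\<in>J. range (root_elt \<zeta>))"
proof -
  let ?R = "(\<Union>\<zeta>\<in>J. range (root_elt \<zeta>)) :: ('k ^ spin ^ spin) set"
  have "{root_elt \<zeta> t |\<zeta> t. \<zeta> \<in> J} = ?R" by blast
  moreover have "?R \<subseteq> U I" using assms(2) root_elt_in_U by blast
  from group.generate_consistent[OF group_B3_group this U_subgroup[OF assms(1)]]
  have "generate (U_group I) ?R = generate B3_group ?R" .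
  ultimately show ?thesis unfolding U_def[of J] by (simp only:)
qed

declare split_paired_All [simp del] split_paired_Ex [simp del]

lemma root_vec_nonzero: "root_vec \<zeta> $ b' $ b \<noteq> 0 \<Longrightarrow> wt b' = wt b + (\<zeta> + \<zeta>)"
  by (simp add: root_vec_def split: if_splits)

lemma raises_root_vecI:
  "(\<And>b b'. wt b' = wt b + (\<zeta> + \<zeta>) \<Longrightarrow> P b' \<and> \<not> P b) \<Longrightarrow> raises P (root_vec \<zeta>)"
  unfolding raises_def using root_vec_nonzero by blast

lemma preserves_root_vecI:
  "(\<And>b b'. wt b' = wt b + (\<zeta> + \<zeta>) \<Longrightarrow> P b' = P b) \<Longrightarrow> preserves P (root_vec \<zeta>)"
  unfolding preserves_def using root_vec_nonzero by blast

lemma root_vec_commute: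
  assumes "\<zeta> \<in> B3" "\<eta> \<in> B3" "\<zeta> + \<eta> \<notin> B3" "\<zeta> + \<eta> \<noteq> 0"
  shows "root_vec \<zeta> ** root_vec \<eta> = (root_vec \<eta> ** root_vec \<zeta> :: 'k::comm_ring_1 ^ spin ^ spin)"
  using bracket_nonroot[OF assms] by simp

lemma unipotent_power:
  assumes "raises P N"
  shows "A = mat 1 + N \<Longrightarrow> A [^]\<^bsub>U_group I\<^esub> (n::nat) = mat 1 + scale (of_nat n) N"
proof (induction n)
  case 0
  then show ?case by (simp add: vec_eq_iff)
next
  case (Suc n)
  have "(mat 1 + scale (of_nat n) N) ** (mat 1 + N) = mat 1 + (scale (of_nat n) N + N)"
    by (rule unipotent_mult[OF raises_scale[OF assms] assms])
  also have "scale (of_nat n) N + N = scale (of_nat (Suc n)) N"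
    by (simp add: vec_eq_iff algebra_simps)
  finally show ?case using Suc by simp
qed

text \<open>A grading of the weights that \<open>A\<close> raises and \<open>Y\<close>,
  \<open>Z\<close> preserve provides the semidirect structure. The condition on
  \<open>Z ** (A ** Z)\<close> removes the quadratic term in \<open>t\<close> from the commutator of
  \<open>z t\<close> and \<open>a 1\<close>, so \<open>e\<close> is a one-parameter
  subgroup.\<close>

lemma amalgam_U_group:
  fixes \<alpha> \<eta> \<zeta> :: vec3 and P :: "spin \<Rightarrow> bool"
  defines "A \<equiv> root_vec \<alpha> :: 'k::{field,finite} ^ spin ^ spin"
    and "Y \<equiv> root_vec \<eta> :: 'k ^ spin ^ spin" and "Z \<equiv> root_vec \<zeta> :: 'k ^ spin ^ spin"
  assumes card: "CARD('k) = 5"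
    and B3: "\<alpha> \<in> B3" "\<eta> \<in> B3" "\<zeta> \<in> B3"
    and A: "raises P A" and Y: "preserves P Y" and Z: "preserves P Z"
    and AY: "A ** Y = Y ** A" and ZAZ: "Z ** (A ** Z) = 0"
  shows "amalgam (U_group {\<alpha>, \<eta>, \<zeta>}) (root_elt \<alpha>) (root_elt \<eta>) (root_elt \<zeta>)
    (\<lambda>t. mat 1 + scale t (Z ** A + scale (- 1) (A ** Z))) (diag_part P)"
proof -
  let ?I = "{\<alpha>, \<eta>, \<zeta>}" and ?e = "\<lambda>t. mat 1 + scale t (Z ** A + scale (- 1) (A ** Z))"
  let ?G = "U_group ?I :: ('k ^ spin ^ spin) monoid"
  have I: "?I \<subseteq> B3" using B3 by simp
  interpret group ?G by (rule group_U_group[OF I])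
  have root_A: "root_elt \<alpha> t = mat 1 + scale t A" and root_Y: "root_elt \<eta> t = mat 1 + scale t Y"
    and root_Z: "root_elt \<zeta> t = mat 1 + scale t Z" for t
    by (simp_all add: root_elt_eq A_def Y_def Z_def)
  have ZZ: "Z ** Z = 0" unfolding Z_def by (rule root_vec_square[OF B3(3)])
  let ?W = "Z ** A + scale (- 1) (A ** Z)"
  have W: "raises P ?W"
    by (intro raises_add raises_scale raises_mult_preserves preserves_mult_raises A Z)
  have eW: "raises P (scale t ?W)" for t by (rule raises_scale[OF W])
  have hom: "one_param (root_elt \<xi> :: 'k \<Rightarrow> _)" if "\<xi> \<in> ?I" for \<xi>
    using that I by (auto simp: one_param_def root_elt_in_U root_elt_add)
  have AA: "A ** A = 0" by (rule raises_mult_raises[OF A A])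
  have AZA: "A ** (Z ** A) = 0"
    by (rule raises_mult_raises[OF A preserves_mult_raises[OF Z A]])
  have AAX: "A ** (A ** X) = 0" for X using AA by (simp add: matrix_mul_assoc)
  have AZAX: "A ** (Z ** (A ** X)) = 0" for X using AZA by (simp add: matrix_mul_assoc)
  have za: "root_elt \<zeta> t ** root_elt \<alpha> 1 = root_elt \<alpha> 1 ** ?e t ** root_elt \<zeta> t" for t
    unfolding root_A root_Z
    by (simp only: expand_simps ZZ ZAZ AA AAX AZA AZAX) (simp add: vec_eq_iff algebra_simps)
  have e_closed: "?e t \<in> U ?I" for t
  proof -
    \<comment> \<open>As a commutator of root elements, \<open>?e t\<close> lies in the
      group.\<close>
    have "root_elt \<zeta> t ** root_elt \<alpha> 1 ** root_elt \<zeta> (- t) ** root_elt \<alpha> (- 1) = ?e t"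
      unfolding root_A root_Z
      by (simp only: expand_simps ZZ ZAZ AA AAX AZA AZAX) (simp add: vec_eq_iff algebra_simps)
    moreover have "root_elt \<zeta> t ** root_elt \<alpha> 1 ** root_elt \<zeta> (- t) ** root_elt \<alpha> (- 1) \<in> carrier ?G"
      using m_closed[of "root_elt \<zeta> t ** root_elt \<alpha> 1 ** root_elt \<zeta> (- t)" "root_elt \<alpha> (- 1)"]
        m_closed[of "root_elt \<zeta> t ** root_elt \<alpha> 1" "root_elt \<zeta> (- t)"]
        m_closed[of "root_elt \<zeta> t" "root_elt \<alpha> 1"]
      by (simp add: root_elt_in_U)
    ultimately show ?thesis by simp
  qed
  have tri: "triangular P (root_elt \<xi> t :: 'k ^ spin ^ spin)" if "\<xi> \<in> ?I" for \<xi> t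
    using that
  proof (elim insertE emptyE)
    assume "\<xi> = \<alpha>"
    then show ?thesis using triangularI(1)[OF raises_scale[OF A]] by (simp add: root_A)
  next
    assume "\<xi> = \<eta>"
    then show ?thesis using triangularI(2)[OF preserves_add[OF preserves_one preserves_scale[OF Y]]]
      by (simp add: root_Y)
  next
    assume "\<xi> = \<zeta>"
    then show ?thesis using triangularI(2)[OF preserves_add[OF preserves_one preserves_scale[OF Z]]]
      by (simp add: root_Z)
  qed
  have gen: "carrier ?G = generate ?G (range (root_elt \<alpha>) \<union> range (root_elt \<eta>) \<union> range (root_elt \<zeta>))"
    using U_subset_generate[OF I order_refl] by (simp add: Un_ac)
  have tri_U: "triangular P g" if "g \<in> U ?I" for g :: "'k ^ spin ^ spin"
  proof -
    have "g \<in> generate ?G (\<Union>\<xi>\<in>?I. range (root_elt \<xi>))"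
      using equalityD1[OF U_subset_generate[OF I order_refl]] that by (rule subsetD)
    then show ?thesis
    proof (induction rule: generate_right_induct)
      case (inv s)
      then obtain \<xi> t where "\<xi> \<in> ?I" "s = root_elt \<xi> t" by blast
      then show ?case using one_param_inv[OF hom] by auto
    next
      case one
      then show ?case using triangularI(2)[OF preserves_one] by simp
    next
      case (right g s)
      then obtain \<xi> t where "\<xi> \<in> ?I" "s = root_elt \<xi> t" by blast
      then show ?case using tri right triangular_mult[of P g s] by simp
    qed (auto simp: root_elt_in_U)
  qed
  have ker: "\<exists>N. raises P N \<and> g = mat 1 + N" if "g \<in> U ?I" "diag_part P g = mat 1" for g :: "'k ^ spin ^ spin"
    using diag_part_eq_1[OF tri_U that(2)] that(1) by metis
  show ?thesis
  proof (intro amalgam.intro amalgam_axioms.intro)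
    show "group ?G" by (rule is_group)
    show "CARD('k) = 5" by (rule card)
    show "finite (carrier ?G)" by simp
    show "one_param (root_elt \<alpha> :: 'k \<Rightarrow> _)" "one_param (root_elt \<eta> :: 'k \<Rightarrow> _)" "one_param (root_elt \<zeta> :: 'k \<Rightarrow> _)"
      by (auto intro: hom)
    show "one_param ?e"
      using e_closed unipotent_mult[OF eW eW]
      by (auto simp: one_param_def vec_eq_iff algebra_simps)
    show "carrier ?G = generate ?G (range (root_elt \<alpha>) \<union> range (root_elt \<eta>) \<union> range (root_elt \<zeta>))"
      by (rule gen)
    show "diag_part P (g \<otimes>\<^bsub>?G\<^esub> h) = diag_part P g \<otimes>\<^bsub>?G\<^esub> diag_part P h"
      if "g \<in> carrier ?G" "h \<in> carrier ?G" for g h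
      using diag_part_mult[OF tri_U tri_U, of g h] that by simp
    show "diag_part P (root_elt \<alpha> t) = \<one>\<^bsub>?G\<^esub>" for t :: 'k
      by (simp add: root_A diag_part_raises raises_scale A)
    show "diag_part P (root_elt \<eta> t) = root_elt \<eta> t" for t :: 'k
      unfolding root_Y by (intro diag_part_preserves preserves_add preserves_one preserves_scale Y)
    show "diag_part P (root_elt \<zeta> t) = root_elt \<zeta> t" for t :: 'k
      unfolding root_Z by (intro diag_part_preserves preserves_add preserves_one preserves_scale Z)
    show "diag_part P (?e t) = \<one>\<^bsub>?G\<^esub>" for t
      using diag_part_raises[OF eW] by simp
    show "p \<otimes>\<^bsub>?G\<^esub> q = q \<otimes>\<^bsub>?G\<^esub> p"
      if pq: "p \<in> carrier ?G" "q \<in> carrier ?G" "diag_part P p = \<one>\<^bsub>?G\<^esub>" "diag_part P q = \<one>\<^bsub>?G\<^esub>" for p q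
    proof -
      obtain M N where "raises P M" "p = mat 1 + M" "raises P N" "q = mat 1 + N"
        using ker[of p] ker[of q] pq by auto
      then show ?thesis by (simp add: unipotent_mult add.commute[of M])
    qed
    show "q [^]\<^bsub>?G\<^esub> (5::nat) = \<one>\<^bsub>?G\<^esub>" if q: "q \<in> carrier ?G" "diag_part P q = \<one>\<^bsub>?G\<^esub>" for q
    proof -
      obtain N where N: "raises P N" "q = mat 1 + N" using ker[of q] q by auto
      have "CHAR('k) dvd 5" using CHAR_dvd_CARD[where 'a = 'k] card by simp
      then have "of_nat 5 = (0 :: 'k)" by (simp only: of_nat_eq_0_iff_char_dvd)
      then have "scale (of_nat 5) N = 0" by (simp only: vec_eq_iff scale_nth) simp
      then show ?thesis using unipotent_power[OF N(1,2), of ?I 5] by simp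
    qed
    show "root_elt \<alpha> s \<otimes>\<^bsub>?G\<^esub> root_elt \<eta> t = root_elt \<eta> t \<otimes>\<^bsub>?G\<^esub> root_elt \<alpha> s" for s t
      unfolding root_A root_Y U_group_simps
      by (simp only: expand_simps AY) (simp add: vec_eq_iff algebra_simps)
    show "root_elt \<zeta> t \<otimes>\<^bsub>?G\<^esub> root_elt \<alpha> 1 = root_elt \<alpha> 1 \<otimes>\<^bsub>?G\<^esub> ?e t \<otimes>\<^bsub>?G\<^esub> root_elt \<zeta> t" for t
      using za by simp
  qed
qed

section \<open>The two links\<close>

lemma B3_roots: "root_alpha \<in> B3" "root_beta \<in> B3" "root_psi \<in> B3" "root_omega \<in> B3"
  by (simp_all add: B3_def root_alpha_def root_beta_def root_psi_def root_omega_def)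

text \<open>The orthogonal roots \<open>root_alpha\<close> and \<open>root_psi\<close> provide the
  commuting pair \<open>a\<close>, \<open>y\<close>, and \<open>root_beta\<close> provides
  \<open>z\<close>. The conjugates of \<open>z\<close> by \<open>y\<close> commute, so this is the
  abelian case.\<close>

lemma vanishing_LB3_lg:
  assumes card: "CARD('k::{field,finite}) = 5"
  shows "vanishing_1_cohomology (LB3_lg TYPE('k))"
proof -
  define A Y Z :: "'k ^ spin ^ spin"
    where "A = root_vec root_alpha" and "Y = root_vec root_psi" and "Z = root_vec root_beta"
  let ?G = "U_group {root_alpha, root_psi, root_beta} :: ('k ^ spin ^ spin) monoid"
  \<comment> \<open>\<open>?P1\<close> gives the semidirect structure, \<open>?P2\<close> makes the
    conjugates of \<open>Z\<close> by \<open>Y\<close> commute, and \<open>?P3\<close> makes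
    \<open>Z ** (A ** Z)\<close> vanish.\<close>
  let ?P1 = "\<lambda>b :: spin. fst b" and ?P2 = "\<lambda>b :: spin. fst (snd b)" and ?P3 = "\<lambda>b :: spin. \<not> snd (snd b)"
  have raises: "raises ?P1 A" "raises ?P2 Z" "raises ?P3 Z"
    unfolding A_def Z_def
    by (rule raises_root_vecI; auto simp: root_alpha_def root_beta_def split: if_splits)+
  have preserves: "preserves ?P1 Y" "preserves ?P1 Z" "preserves ?P2 Y" "preserves ?P3 A"
    unfolding A_def Y_def Z_def
    by (rule preserves_root_vecI; auto simp: root_alpha_def root_beta_def root_psi_def split: if_splits)+
  have AY: "A ** Y = Y ** A"
    unfolding A_def Y_def
    by (rule root_vec_commute) (simp_all add: B3_roots, simp_all add: B3_def root_alpha_def root_psi_def zero_prod_def)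
  have ZAZ: "Z ** (A ** Z) = 0"
    by (rule raises_mult_raises[OF raises(3) preserves_mult_raises[OF preserves(4) raises(3)]])
  have YY: "Y ** Y = 0" unfolding Y_def by (rule root_vec_square[OF B3_roots(3)])
  interpret amalgam ?G "root_elt root_alpha" "root_elt root_psi" "root_elt root_beta"
    "\<lambda>t. mat 1 + scale t (Z ** A + scale (- 1) (A ** Z))" "diag_part ?P1"
    using amalgam_U_group[OF card B3_roots(1,3,2), of ?P1] raises preserves AY ZAZ
    unfolding A_def Y_def Z_def by blast
  define N where "N s = Z + scale s (Y ** Z + scale (- 1) (Z ** Y)) + scale (- (s * s)) (Y ** (Z ** Y))" for s
  have w_eq: "w s t = mat 1 + scale t (N s)" for s t
    unfolding w_def U_group_simps root_elt_eq Y_def[symmetric] Z_def[symmetric] conj_expand YY N_def by simp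
  have N: "raises ?P2 (N s)" for s
    unfolding N_def
    by (intro raises_add raises_scale raises_mult_preserves preserves_mult_raises raises preserves)
  have w_mult: "(mat 1 + M) ** (mat 1 + scale t (N s)) = mat 1 + (M + scale t (N s))" if "raises ?P2 M" for M s t
    by (rule unipotent_mult[OF that raises_scale[OF N]])
  have conn: "connected H" if H: "subgroup H ?G" for H
  proof (rule connected_abelian[OF _ _ H])
    show "w s t \<otimes>\<^bsub>?G\<^esub> w s' t' = w s' t' \<otimes>\<^bsub>?G\<^esub> w s t" for s t s' t'
      by (simp add: w_eq w_mult raises_scale N add.commute[of "scale t (N s)"])
    show "\<exists>t0 t1 t2. w s t = w 0 t0 \<otimes>\<^bsub>?G\<^esub> w 1 t1 \<otimes>\<^bsub>?G\<^esub> w (- 1) t2" for s t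
    proof (intro exI)
      \<comment> \<open>\<open>N s\<close> is quadratic in \<open>s\<close>, hence determined by the
        nodes 0, 1 and -1. Up to the factor \<open>t\<close>, the exponents are the Lagrange
        coefficients \<open>1 - s * s\<close>, \<open>(s * s + s) / 2\<close> and
        \<open>(s * s - s) / 2\<close>.\<close>
      define p q where "p = t * (s * s + s) / 2" and "q = t * (s * s - s) / 2"
      have "p + q = (2 * (t * s * s)) / 2" "p - q = (2 * (t * s)) / 2"
        unfolding p_def q_def add_divide_distrib[symmetric] diff_divide_distrib[symmetric]
        by (simp_all add: algebra_simps)
      then have pq: "p + q = t * s * s" "p - q = t * s"
        using two_neq_0[OF card] by simp_all
      have "w 0 (t - t * s * s) \<otimes>\<^bsub>?G\<^esub> w 1 p \<otimes>\<^bsub>?G\<^esub> w (- 1) q =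
          mat 1 + (scale (t - t * s * s) (N 0) + scale p (N 1) + scale q (N (- 1)))"
        unfolding w_eq U_group_simps by (simp add: w_mult raises_add raises_scale N)
      also have "scale (t - t * s * s) (N 0) + scale p (N 1) + scale q (N (- 1)) = scale t (N s)"
      proof -
        have "(t - t * s * s) * a + p * (a + (b - b') - c) + q * (a + (b' - b) - c) =
            t * (a + s * (b - b') - s * s * c)" for a b b' c
        proof -
          have "(t - t * s * s) * a + p * (a + (b - b') - c) + q * (a + (b' - b) - c) =
              (t - t * s * s + (p + q)) * a + (p - q) * (b - b') - (p + q) * c"
            by (simp add: algebra_simps)
          then show ?thesis by (simp add: pq algebra_simps)
        qed
        then show ?thesis by (simp add: vec_eq_iff N_def)
      qed
      finally show "w s t = w 0 (t - t * s * s) \<otimes>\<^bsub>?G\<^esub> w 1 p \<otimes>\<^bsub>?G\<^esub> w (- 1) q"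
        by (simp add: w_eq)
    qed
  qed
  let ?I = "{root_alpha, root_psi, root_beta}"
  have I: "?I \<subseteq> B3" by (simp add: B3_roots)
  have distinct: "root_alpha \<noteq> root_beta" "root_alpha \<noteq> root_psi" "root_beta \<noteq> root_psi"
    by (simp_all add: root_alpha_def root_beta_def root_psi_def)
  then have diff: "?I - {root_alpha} = {root_psi, root_beta}" "?I - {root_beta} = {root_alpha, root_psi}"
      "?I - {root_psi} = {root_alpha, root_beta}"
    by auto
  have U_gen: "(U J :: ('k ^ spin ^ spin) set) = generate ?G (\<Union>\<zeta>\<in>J. range (root_elt \<zeta>))" if "J \<subseteq> ?I" for J
    using I that by (rule U_subset_generate)
  have "vanishing_1_cohomology (coset_complex ?G {root_alpha, root_beta, root_psi} (\<lambda>\<zeta>. U (?I - {\<zeta>})))"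
  proof (rule vanishing_coset_complex[OF conn distinct])
    show "U (?I - {root_alpha}) = generate ?G (range (root_elt root_psi) \<union> range (root_elt root_beta))"
      unfolding diff using U_gen[of "{root_psi, root_beta}"] by simp
    show "U (?I - {root_beta}) = generate ?G (range (root_elt root_alpha) \<union> range (root_elt root_psi))"
      unfolding diff using U_gen[of "{root_alpha, root_psi}"] by simp
    show "U (?I - {root_psi}) = generate ?G (range (root_elt root_alpha) \<union> range (root_elt root_beta))"
      unfolding diff using U_gen[of "{root_alpha, root_beta}"] by simp
  qed
  moreover have "?I = {root_alpha, root_beta, root_psi}" by blast
  ultimately show ?thesis unfolding LB3_lg_def L_complex_def by (simp only:)
qed

text \<open>Now \<open>root_omega\<close> and \<open>root_beta\<close> provide the commuting pair
  \<open>a\<close>, \<open>y\<close>, and \<open>root_psi\<close> provides \<open>z\<close>. The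
  conjugates of \<open>z\<close> by \<open>y\<close> commute only up to the long root subgroup of
  \<open>root_beta + root_psi + root_psi\<close>, so this is the Heisenberg case.\<close>

lemma vanishing_LB3_sm:
  assumes card: "CARD('k::{field,finite}) = 5"
  shows "vanishing_1_cohomology (LB3_sm TYPE('k))"
proof -
  define A Y Z :: "'k ^ spin ^ spin"
    where "A = root_vec root_omega" and "Y = root_vec root_beta" and "Z = root_vec root_psi"
  let ?G = "U_group {root_omega, root_beta, root_psi} :: ('k ^ spin ^ spin) monoid"
  \<comment> \<open>\<open>?P1\<close> gives the semidirect structure, while \<open>?P2\<close> and
    \<open>?P3\<close> make \<open>Y ** (Z ** Y)\<close> and \<open>Z ** (A ** Z)\<close>
    vanish.\<close>
  let ?P1 = "\<lambda>b :: spin. \<not> fst b" and ?P2 = "\<lambda>b :: spin. fst (snd b)" and ?P3 = "\<lambda>b :: spin. snd (snd b)"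
  have raises: "raises ?P1 A" "raises ?P2 Y" "raises ?P3 Z"
    unfolding A_def Y_def Z_def
    by (rule raises_root_vecI;
      auto simp: root_alpha_def root_beta_def root_psi_def root_omega_def split: if_splits)+
  have preserves: "preserves ?P1 Y" "preserves ?P1 Z" "preserves ?P2 Z" "preserves ?P3 A"
    unfolding A_def Y_def Z_def
    by (rule preserves_root_vecI;
      auto simp: root_alpha_def root_beta_def root_psi_def root_omega_def split: if_splits)+
  have AY: "A ** Y = Y ** A"
    unfolding A_def Y_def
    by (rule root_vec_commute) (simp_all add: B3_roots,
      simp_all add: B3_def root_alpha_def root_beta_def root_psi_def root_omega_def zero_prod_def)
  have ZAZ: "Z ** (A ** Z) = 0"
    by (rule raises_mult_raises[OF raises(3) preserves_mult_raises[OF preserves(4) raises(3)]])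
  have YY: "Y ** Y = 0" unfolding Y_def by (rule root_vec_square[OF B3_roots(2)])
  have ZZ: "Z ** Z = 0" unfolding Z_def by (rule root_vec_square[OF B3_roots(3)])
  have YZY: "Y ** (Z ** Y) = 0"
    by (rule raises_mult_raises[OF raises(2) preserves_mult_raises[OF preserves(3) raises(2)]])
  \<comment> \<open>The variants with a tail \<open>X\<close> match vanishing subwords at the start
    of words nested to the right.\<close>
  have zero: "Y ** (Y ** X) = 0" "Z ** (Z ** X) = 0" "Y ** (Z ** (Y ** X)) = 0" for X
    using YY ZZ YZY by (simp_all add: matrix_mul_assoc)
  note words = YY ZZ YZY zero
  \<comment> \<open>The roots are short and orthogonal, so their root vectors anticommute like
    Clifford generators.\<close>
  have ZA: "Z ** A = scale (- 1) (A ** Z)"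
  proof -
    have "(Z ** A) $ b' $ b = - ((A ** Z) $ b' $ b)" for b' b
      unfolding Z_def A_def root_vec_mult_nth
      by (cases b'; cases b) (auto simp: root_alpha_def root_beta_def root_psi_def root_omega_def split: if_splits)
    then show ?thesis by (simp add: vec_eq_iff)
  qed
  interpret amalgam ?G "root_elt root_omega" "root_elt root_beta" "root_elt root_psi"
    "\<lambda>t. mat 1 + scale t (Z ** A + scale (- 1) (A ** Z))" "diag_part ?P1"
    using amalgam_U_group[OF card B3_roots(4,2,3), of ?P1] raises preserves AY ZAZ
    unfolding A_def Y_def Z_def by blast
  have z_eq: "root_elt root_psi t = mat 1 + scale t Z" and y_eq: "root_elt root_beta t = mat 1 + scale t Y"
    and a_eq: "root_elt root_omega t = mat 1 + scale t A" for t
    by (simp_all add: root_elt_eq A_def Y_def Z_def)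
  have w_eq: "w s t = mat 1 + scale t (Z + scale s (Y ** Z + scale (- 1) (Z ** Y)))" for s t
    unfolding w_def U_group_simps y_eq z_eq conj_expand YY YZY by simp
  \<comment> \<open>Up to sign, \<open>Z ** (Y ** Z)\<close> is the root vector of
    \<open>root_beta + root_psi + root_psi\<close>.\<close>
  define r where "r t = mat 1 + scale t (Z ** (Y ** Z))" for t
  \<comment> \<open>Writing \<open>r t\<close> as a commutator of \<open>z (t / 2)\<close> and
    \<open>w 1 1\<close> shows that it lies in \<open>B\<close>.\<close>
  have r_eq: "r t = root_elt root_psi (- (t / 2)) \<otimes>\<^bsub>?G\<^esub> w 1 (- 1) \<otimes>\<^bsub>?G\<^esub> root_elt root_psi (t / 2) \<otimes>\<^bsub>?G\<^esub> w 1 1" for t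
  proof -
    have t: "t = t / 2 + t / 2" using two_neq_0[OF card] by (simp flip: mult_2)
    show ?thesis
      unfolding r_def w_eq z_eq U_group_simps by (subst t) (simp only: expand_simps words,
        simp add: vec_eq_iff algebra_simps)
  qed
  have rB: "r t \<in> B" for t
    unfolding r_eq by (intro B_mult' z_in_B w_in_B)
  have conn: "connected H" if H: "subgroup H ?G" for H
  proof (rule connected_heisenberg[OF _ rB _ _ _ _ _ H])
    show "one_param r"
      using rB B_closed by (auto simp: one_param_def r_def expand_simps words) (auto simp: vec_eq_iff algebra_simps)
    show "r s \<otimes>\<^bsub>?G\<^esub> root_elt root_beta t = root_elt root_beta t \<otimes>\<^bsub>?G\<^esub> r s" for s t
      unfolding r_def y_eq U_group_simps
      by (simp only: expand_simps words) (simp add: vec_eq_iff algebra_simps)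
    show "r s \<otimes>\<^bsub>?G\<^esub> root_elt root_psi t = root_elt root_psi t \<otimes>\<^bsub>?G\<^esub> r s" for s t
      unfolding r_def z_eq U_group_simps
      by (simp only: expand_simps words) (simp add: vec_eq_iff algebra_simps)
    show "r s \<otimes>\<^bsub>?G\<^esub> root_elt root_omega 1 = root_elt root_omega 1 \<otimes>\<^bsub>?G\<^esub> r s" for s
    proof -
      \<comment> \<open>Moving \<open>A\<close> to the left passes \<open>Z\<close> twice, so the
        two signs cancel, and \<open>Y\<close> commutes with \<open>A\<close>.\<close>
      have "Z ** (Y ** (Z ** A)) = A ** (Z ** (Y ** Z))"
      proof -
        have "Z ** (Y ** (Z ** A)) = scale (- 1) (Z ** ((Y ** A) ** Z))"
          unfolding ZA by (simp add: expand_simps)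
        also have "\<dots> = scale (- 1) ((Z ** A) ** (Y ** Z))"
          unfolding AY[symmetric] by (simp add: matrix_mul_assoc)
        also have "\<dots> = A ** (Z ** (Y ** Z))"
          unfolding ZA by (simp add: expand_simps) (simp add: vec_eq_iff)
        finally show ?thesis .
      qed
      then show ?thesis
        unfolding r_def a_eq U_group_simps
        by (simp only: expand_simps) (simp add: vec_eq_iff algebra_simps)
    qed
    show "root_elt root_psi s \<otimes>\<^bsub>?G\<^esub> w 1 t = w 1 t \<otimes>\<^bsub>?G\<^esub> root_elt root_psi s \<otimes>\<^bsub>?G\<^esub> r (2 * s * t)" for s t
      unfolding r_def z_eq w_eq U_group_simps
      by (simp only: expand_simps words) (simp add: vec_eq_iff algebra_simps)
    show "\<exists>t0 t1 t2. w s t = root_elt root_psi t0 \<otimes>\<^bsub>?G\<^esub> w 1 t1 \<otimes>\<^bsub>?G\<^esub> r t2" for s t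
    proof (intro exI)
      \<comment> \<open>The first two exponents match the coefficients of \<open>Z\<close> and of
        the bracket of \<open>Y\<close> and \<open>Z\<close>. Their product contributes one more
        multiple of \<open>Z ** (Y ** Z)\<close>, which \<open>r\<close> cancels.\<close>
      show "w s t = root_elt root_psi (t - t * s) \<otimes>\<^bsub>?G\<^esub> w 1 (t * s) \<otimes>\<^bsub>?G\<^esub> r (- ((t - t * s) * (t * s)))"
        unfolding r_def z_eq w_eq U_group_simps
        by (simp only: expand_simps words) (simp add: vec_eq_iff algebra_simps)
    qed
  qed
  let ?I = "{root_omega, root_beta, root_psi}"
  have I: "?I \<subseteq> B3" by (simp add: B3_roots)
  have distinct: "root_omega \<noteq> root_psi" "root_omega \<noteq> root_beta" "root_psi \<noteq> root_beta"
    by (simp_all add: root_alpha_def root_beta_def root_psi_def root_omega_def)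
  then have diff: "?I - {root_omega} = {root_beta, root_psi}" "?I - {root_psi} = {root_omega, root_beta}"
      "?I - {root_beta} = {root_omega, root_psi}"
    by auto
  have U_gen: "(U J :: ('k ^ spin ^ spin) set) = generate ?G (\<Union>\<zeta>\<in>J. range (root_elt \<zeta>))" if "J \<subseteq> ?I" for J
    using I that by (rule U_subset_generate)
  have "vanishing_1_cohomology (coset_complex ?G {root_omega, root_psi, root_beta} (\<lambda>\<zeta>. U (?I - {\<zeta>})))"
  proof (rule vanishing_coset_complex[OF conn distinct])
    show "U (?I - {root_omega}) = generate ?G (range (root_elt root_beta) \<union> range (root_elt root_psi))"
      unfolding diff using U_gen[of "{root_beta, root_psi}"] by simp
    show "U (?I - {root_psi}) = generate ?G (range (root_elt root_omega) \<union> range (root_elt root_beta))"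
      unfolding diff using U_gen[of "{root_omega, root_beta}"] by simp
    show "U (?I - {root_beta}) = generate ?G (range (root_elt root_omega) \<union> range (root_elt root_psi))"
      unfolding diff using U_gen[of "{root_omega, root_psi}"] by simp
  qed
  moreover have "?I = {root_beta, root_psi, root_omega}" "{root_omega, root_psi, root_beta} = {root_beta, root_psi, root_omega}"
    by blast+
  ultimately show ?thesis unfolding LB3_sm_def L_complex_def by (simp only:)
qed

theorem theorem5p2:
  assumes "CARD('k::{field,finite}) = 5"
  shows "vanishing_1_cohomology (LB3_sm TYPE('k)) \<and>
         vanishing_1_cohomology (LB3_lg TYPE('k))"
  using vanishing_LB3_sm[OF assms] vanishing_LB3_lg[OF assms] by blast

end
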